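(* The problem of finding optimal strategies in the game HSPE has a fully polynomial time approximation scheme. That is, given $\varepsilon>0$, there exists an algorithm, running in time polynomial in $n$ and $1/\varepsilon$, that computes $(1+\varepsilon)$-optimal mixed strategies for the Hider and the Searcher in HSPE, where $n$ is the number of locations.
   Context: The game HSPE (hide-seek and pursuit-evasion) is a zero-sum game between a Hider and a Searcher. There are $n$ locations $[n]=\{1,\ldots,n\}$; location $j$ has a search cost $c_j$ and a capture probability $p_j$, and a number $k$ is given. A pure strategy for the Hider is a location $j\in[n]$. A pure strategy for the Searcher is a subset $S\subseteq[n]$ of locations, the sum of whose search costs does not exceed $k$, i.e. $\sum_{i\in S}c_i\le k$. If the Hider's location $j$ lies in $S$, a pursuit ensues and the Searcher captures the Hider with probability $p_j$; otherwise the Hider is not captured. The payoff, which the Hider wishes to minimize and the Searcher to maximize, is the probability that the Hider is captured: it equals $p_j$ if $j\in S$ and $0$ if $j\notin S$. Payoffs are extended to mixed strategies by expectation. Let $V^*$ be the value of the game. For $\alpha\ge 1$, a mixed strategy of the maximizing player (here the Searcher) is $\alpha$-optimal if it guarantees an expected payoff of at least $V^*/\alpha$ against every strategy of the opponent; a mixed strategy of the minimizing player (here the Hider) is $\alpha$-optimal if it guarantees an expected payoff of at most $\alpha V^*$ against every strategy of the opponent. Mixed strategies are represented in sparse form, as a list of the indices of the non-zero entries together with their values. *)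

theory Defs
  imports "HOL-Probability.Probability" "HOL-Computational_Algebra.Polynomial"
begin

section \<open>Zero-sum games\<close>

text \<open>The row player has pure strategies \<open>X\<close> and maximizes the payoff \<open>A\<close>; the column player
  has pure strategies \<open>Y\<close> and minimizes it.\<close>

definition mixed :: "'a set \<Rightarrow> 'a pmf set" where
  "mixed X = {x. set_pmf x \<subseteq> X}"

definition exp_payoff :: "('a \<Rightarrow> 'b \<Rightarrow> real) \<Rightarrow> 'a pmf \<Rightarrow> 'b pmf \<Rightarrow> real" where
  "exp_payoff A x y = measure_pmf.expectation (pair_pmf x y) (\<lambda>(i, j). A i j)"

text \<open>The value is taken in its maximin form. For finite non-empty \<open>X\<close> and \<open>Y\<close>, the only case used
  below, both extrema are attained and, by the minimax theorem, may be exchanged.\<close>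

definition game_value :: "('a \<Rightarrow> 'b \<Rightarrow> real) \<Rightarrow> 'a set \<Rightarrow> 'b set \<Rightarrow> real" where
  "game_value A X Y = (SUP x\<in>mixed X. INF y\<in>mixed Y. exp_payoff A x y)"

definition optimal_max :: "('a \<Rightarrow> 'b \<Rightarrow> real) \<Rightarrow> 'a set \<Rightarrow> 'b set \<Rightarrow> real \<Rightarrow> 'a pmf \<Rightarrow> bool" where
  "optimal_max A X Y \<alpha> x \<longleftrightarrow>
     x \<in> mixed X \<and> (\<forall>y\<in>mixed Y. exp_payoff A x y \<ge> game_value A X Y / \<alpha>)"

definition optimal_min :: "('a \<Rightarrow> 'b \<Rightarrow> real) \<Rightarrow> 'a set \<Rightarrow> 'b set \<Rightarrow> real \<Rightarrow> 'b pmf \<Rightarrow> bool" where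
  "optimal_min A X Y \<alpha> y \<longleftrightarrow>
     y \<in> mixed Y \<and> (\<forall>x\<in>mixed X. exp_payoff A x y \<le> \<alpha> * game_value A X Y)"

definition sparse_form :: "('a \<times> real) list \<Rightarrow> 'a pmf \<Rightarrow> bool" where
  "sparse_form L x \<longleftrightarrow> distinct (map fst L) \<and> set L = {(i, pmf x i) | i. pmf x i \<noteq> 0}"


section \<open>The game HSPE\<close>

definition hspe_instance :: "nat \<Rightarrow> (nat \<Rightarrow> real) \<Rightarrow> (nat \<Rightarrow> real) \<Rightarrow> real \<Rightarrow> bool" where
  "hspe_instance n c p k \<longleftrightarrow>
     n \<ge> 1 \<and> k \<ge> 0 \<and> (\<forall>j\<in>{1..n}. c j \<ge> 0 \<and> 0 \<le> p j \<and> p j \<le> 1)"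

definition searcher_pure :: "nat \<Rightarrow> (nat \<Rightarrow> real) \<Rightarrow> real \<Rightarrow> nat set set" where
  "searcher_pure n c k = {S. S \<subseteq> {1..n} \<and> (\<Sum>i\<in>S. c i) \<le> k}"

definition hider_pure :: "nat \<Rightarrow> nat set" where
  "hider_pure n = {1..n}"

definition hspe_payoff :: "(nat \<Rightarrow> real) \<Rightarrow> nat set \<Rightarrow> nat \<Rightarrow> real" where
  "hspe_payoff p S j = (if j \<in> S then p j else 0)"


section \<open>Algorithms\<close>

text \<open>
  Algorithms are programs of a random access machine over the reals: memory cells hold exact real
  numbers or natural numbers (indices and counters), and are addressed as entries of arrays with
  two indices. The real operations are the field operations and comparison; there is no rounding
  operation, and there is no map from reals to natural numbers. Natural numbers have addition and
  truncated subtraction but no multiplication. Only integer constants may occur in a program.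

  Every assignment and every test costs one unit. This counts machine operations up to a constant
  factor, since the finitely many expressions in a given program have bounded size.
\<close>

type_synonym name = string

datatype iexp =
    INum nat
  | IGet name iexp iexp
  | IAdd iexp iexp
  | ISub iexp iexp

datatype rexp =
    RNum int
  | RGet name iexp iexp
  | RAdd rexp rexp
  | RSub rexp rexp
  | RMul rexp rexp
  | RDiv rexp rexp

datatype bexp =
    ILess iexp iexp
  | RLess rexp rexp
  | BNot bexp
  | BAnd bexp bexp

datatype com =
    Skip
  | ISet name iexp iexp iexp
  | RSet name iexp iexp rexp
  | Seq com com
  | Cond bexp com com
  | While bexp com

datatype state =
  State (imem: "name \<Rightarrow> nat \<Rightarrow> nat \<Rightarrow> nat") (rmem: "name \<Rightarrow> nat \<Rightarrow> nat \<Rightarrow> real")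

primrec ival :: "iexp \<Rightarrow> state \<Rightarrow> nat" where
  "ival (INum m) s = m"
| "ival (IGet a e f) s = imem s a (ival e s) (ival f s)"
| "ival (IAdd e f) s = ival e s + ival f s"
| "ival (ISub e f) s = ival e s - ival f s"

primrec rval :: "rexp \<Rightarrow> state \<Rightarrow> real" where
  "rval (RNum z) s = of_int z"
| "rval (RGet a e f) s = rmem s a (ival e s) (ival f s)"
| "rval (RAdd e f) s = rval e s + rval f s"
| "rval (RSub e f) s = rval e s - rval f s"
| "rval (RMul e f) s = rval e s * rval f s"
| "rval (RDiv e f) s = rval e s / rval f s"

primrec bval :: "bexp \<Rightarrow> state \<Rightarrow> bool" where
  "bval (ILess e f) s = (ival e s < ival f s)"
| "bval (RLess e f) s = (rval e s < rval f s)"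
| "bval (BNot b) s = (\<not> bval b s)"
| "bval (BAnd b d) s = (bval b s \<and> bval d s)"

definition update :: "(name \<Rightarrow> nat \<Rightarrow> nat \<Rightarrow> 'v) \<Rightarrow> name \<Rightarrow> nat \<Rightarrow> nat \<Rightarrow> 'v \<Rightarrow> name \<Rightarrow> nat \<Rightarrow> nat \<Rightarrow> 'v"
  where "update m a i j v = m(a := (m a)(i := (m a i)(j := v)))"

text \<open>\<open>exec P s t s'\<close>: started in state \<open>s\<close>, \<open>P\<close> halts in state \<open>s'\<close> after exactly \<open>t\<close> steps.\<close>

inductive exec :: "com \<Rightarrow> state \<Rightarrow> nat \<Rightarrow> state \<Rightarrow> bool" where
  Skip: "exec Skip s 1 s"
| ISet: "exec (ISet a e f g) s 1
           (State (update (imem s) a (ival e s) (ival f s) (ival g s)) (rmem s))"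
| RSet: "exec (RSet a e f g) s 1
           (State (imem s) (update (rmem s) a (ival e s) (ival f s) (rval g s)))"
| Seq: "exec P s t s' \<Longrightarrow> exec Q s' u s'' \<Longrightarrow> exec (Seq P Q) s (t + u) s''"
| CondTrue: "bval b s \<Longrightarrow> exec P s t s' \<Longrightarrow> exec (Cond b P Q) s (t + 1) s'"
| CondFalse: "\<not> bval b s \<Longrightarrow> exec Q s t s' \<Longrightarrow> exec (Cond b P Q) s (t + 1) s'"
| WhileFalse: "\<not> bval b s \<Longrightarrow> exec (While b P) s 1 s"
| WhileTrue: "bval b s \<Longrightarrow> exec P s t s' \<Longrightarrow> exec (While b P) s' u s''
                \<Longrightarrow> exec (While b P) s (t + u + 1) s''"

inductive_cases exec_SkipE: "exec Skip s t s'"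
inductive_cases exec_ISetE: "exec (ISet a e f g) s t s'"
inductive_cases exec_RSetE: "exec (RSet a e f g) s t s'"
inductive_cases exec_SeqE: "exec (Seq P Q) s t s'"
inductive_cases exec_CondE: "exec (Cond b P Q) s t s'"
inductive_cases exec_WhileE: "exec (While b P) s t s'"

lemma exec_deterministic:
  "exec P s t s' \<Longrightarrow> exec P s u s'' \<Longrightarrow> t = u \<and> s' = s''"
proof (induction arbitrary: u s'' rule: exec.induct)
  case (Skip s)
  then show ?case by (rule exec_SkipE) simp
next
  case (ISet a e f g s)
  then show ?case by (rule exec_ISetE) simp
next
  case (RSet a e f g s)
  then show ?case by (rule exec_RSetE) simp
next
  case (Seq P s t s1 Q v s2)
  from Seq.prems show ?case by (rule exec_SeqE) (metis Seq.IH)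
next
  case (CondTrue b s P t s' Q)
  from CondTrue.prems show ?case by (rule exec_CondE) (use CondTrue.hyps(1) in \<open>auto dest!: CondTrue.IH\<close>)
next
  case (CondFalse b s Q t s' P)
  from CondFalse.prems show ?case by (rule exec_CondE) (use CondFalse.hyps(1) in \<open>auto dest!: CondFalse.IH\<close>)
next
  case (WhileFalse b s P)
  from WhileFalse.prems show ?case by (rule exec_WhileE) (use WhileFalse.hyps in simp_all)
next
  case (WhileTrue b s P t s1 v s2)
  from WhileTrue.prems show ?case by (rule exec_WhileE) (use WhileTrue.hyps(1) in \<open>auto dest!: WhileTrue.IH\<close>)
qed

text \<open>Cells that do not hold part of the input are initially zero.\<close>

definition hspe_input :: "nat \<Rightarrow> (nat \<Rightarrow> real) \<Rightarrow> (nat \<Rightarrow> real) \<Rightarrow> real \<Rightarrow> real \<Rightarrow> state" where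
  "hspe_input n c p k \<epsilon> = State
     (\<lambda>a i j. if a = ''n'' \<and> i = 0 \<and> j = 0 then n else 0)
     (\<lambda>a i j. if a = ''c'' \<and> i \<in> {1..n} \<and> j = 0 then c i
        else if a = ''p'' \<and> i \<in> {1..n} \<and> j = 0 then p i
        else if a = ''k'' \<and> i = 0 \<and> j = 0 then k
        else if a = ''eps'' \<and> i = 0 \<and> j = 0 then \<epsilon>
        else 0)"

text \<open>The pure strategy in the \<open>i\<close>-th entry of the Searcher's list is the set of locations marked by
  non-zero numbers in row \<open>i\<close> of the array \<open>sset\<close>.\<close>

definition hider_output :: "state \<Rightarrow> (nat \<times> real) list" where
  "hider_output s =
     map (\<lambda>i. (imem s ''hloc'' i 0, rmem s ''hval'' i 0)) [0..<imem s ''hlen'' 0 0]"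

definition searcher_output :: "nat \<Rightarrow> state \<Rightarrow> (nat set \<times> real) list" where
  "searcher_output n s =
     map (\<lambda>i. ({j\<in>{1..n}. imem s ''sset'' i j \<noteq> 0}, rmem s ''sval'' i 0))
       [0..<imem s ''slen'' 0 0]"

text \<open>Polynomials in two variables are polynomials whose coefficients are polynomials.\<close>

definition poly2 :: "real poly poly \<Rightarrow> real \<Rightarrow> real \<Rightarrow> real" where
  "poly2 q u v = poly (poly q [:u:]) v"

end

(*
The Searcher's side is solved by multiplicative weights: the Hider keeps a weight for every
location, the Searcher answers with a nearly optimal set, a knapsack problem that dynamic
programming on rounded rewards solves up to a factor 1 - 1/R, and the weights of the locations
in the set shrink. The empirical distribution of the sets and the average of the suitably
rescaled weights guarantee payoffs whose ratio is at most 1 + eps, so by weak duality both are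
(1 + eps)-optimal; the minimax theorem is not needed.

The number of rounds must not depend on the ratios of the p_j. Therefore the demands 1/p_j are
first increased by a small multiple of their sum, which changes the value of the game only by a
factor close to 1 but makes its width polynomial. Roundings are computed by counting loops, as
the machine cannot convert reals to natural numbers. If some p_j = 0 or c_j > k, the Hider is
safe at j and the value is 0.
*)
theory Submission
  imports Defs
begin

section \<open>Total correctness with time bounds\<close>

text \<open>Put \<open>h = 1/R\<close>. The regret of multiplicative weights is about
  \<open>ln n / h\<close>; it shrinks to a factor near 1 only once the total payoff \<open>C\<close>
  exceeds it by a factor \<open>1/h\<close>. With payoffs \<open>p_j\<close> the value may be
  arbitrarily small against the largest payoff, so no polynomial number of rounds would do. After
  the change of demands the \<open>1/m_j\<close> sum to exactly \<open>n^2 R + n\<close>, a round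
  gains at least about \<open>1/(n^2 R)\<close>, and \<open>4 (n R)^3\<close> rounds lift
  \<open>C\<close> above \<open>n R^2\<close>; \<open>n <= e^n\<close> spares the logarithm.

  Going back, the Searcher loses nothing, as \<open>m_j <= a p_j\<close>. The Hider's weights are
  multiplied by \<open>m_j/p_j\<close> and renormalized. No location is searched in more than all
  rounds, which bounds \<open>C\<close> from above and keeps the normalizer within
  \<open>1 - 2h\<close> of its ideal value \<open>a T\<close>.

  The losses are \<open>1 - h\<close> (oracle), \<open>1 - h\<close> (regret), \<open>1 + 2h\<close>
  (second order of the weight update) and \<open>1 - 2h\<close> (normalizer). Since
  \<open>(1+2h) / ((1-h)^2 (1-2h)) <= 1/(1-8h)\<close>, and \<open>1/(1-8h) <= 1+eps\<close> means
  \<open>R >= 8 + 8/eps\<close>, this is the choice of \<open>R\<close>.\<close>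

lemma update_same: "update m a i j v a k l = (if k = i \<and> l = j then v else m a k l)"
  by (simp add: update_def)

lemma update_other: "b \<noteq> a \<Longrightarrow> update m a i j v b = m b"
  by (simp add: update_def)

lemma update_row: "l \<noteq> i \<Longrightarrow> update M x i j v x l = M x l"
  by (simp add: update_def)

primrec loopfree :: "com \<Rightarrow> bool" where
  "loopfree Skip = True"
| "loopfree (ISet a e f g) = True"
| "loopfree (RSet a e f g) = True"
| "loopfree (Seq P Q) = (loopfree P \<and> loopfree Q)"
| "loopfree (Cond b P Q) = (loopfree P \<and> loopfree Q)"
| "loopfree (While b P) = False"

text \<open>The functions \<open>cost\<close> and \<open>sem\<close> are meaningful only for loop-free programs; their values at
  \<open>While\<close> are junk.\<close>

primrec cost :: "com \<Rightarrow> nat" where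
  "cost Skip = 1"
| "cost (ISet a e f g) = 1"
| "cost (RSet a e f g) = 1"
| "cost (Seq P Q) = cost P + cost Q"
| "cost (Cond b P Q) = cost P + cost Q + 1"
| "cost (While b P) = 0"

primrec sem :: "com \<Rightarrow> state \<Rightarrow> state" where
  "sem Skip s = s"
| "sem (ISet a e f g) s = State (update (imem s) a (ival e s) (ival f s) (ival g s)) (rmem s)"
| "sem (RSet a e f g) s = State (imem s) (update (rmem s) a (ival e s) (ival f s) (rval g s))"
| "sem (Seq P Q) s = sem Q (sem P s)"
| "sem (Cond b P Q) s = (if bval b s then sem P s else sem Q s)"
| "sem (While b P) s = s"

lemma exec_loopfree: "loopfree P \<Longrightarrow> \<exists>t\<le>cost P. exec P s t (sem P s)"
proof (induction P arbitrary: s)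
  case (Seq P Q)
  then obtain t u where "t \<le> cost P" "exec P s t (sem P s)" "u \<le> cost Q"
      "exec Q (sem P s) u (sem Q (sem P s))"
    by (metis loopfree.simps(4))
  then show ?case by (auto intro!: exI[of _ "t + u"] exec.Seq)
next
  case (Cond b P Q)
  then obtain t u where "t \<le> cost P" "exec P s t (sem P s)" "u \<le> cost Q" "exec Q s u (sem Q s)"
    by (metis loopfree.simps(5))
  then show ?case
    using exec.CondTrue[of b s P t "sem P s" Q] exec.CondFalse[of b s Q u "sem Q s" P]
    by (cases "bval b s") (auto intro: exI[of _ "t + 1"] exI[of _ "u + 1"])
qed (auto intro: exec.intros exI[of _ 1])

text \<open>Since \<open>exec\<close> is deterministic, the existence of one run within the budget
  already describes every run.\<close>

definition wp :: "com \<Rightarrow> nat \<Rightarrow> (state \<Rightarrow> bool) \<Rightarrow> state \<Rightarrow> bool" where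
  "wp P T Q s \<longleftrightarrow> (\<exists>t s'. exec P s t s' \<and> t \<le> T \<and> Q s')"

text \<open>Reduces loop-free code to symbolic execution: the simplifier evaluates
  \<open>sem P s\<close>, and the budget is syntactic because \<open>cost\<close> charges both
  branches of a conditional.\<close>

lemma wp_loopfree: "loopfree P \<Longrightarrow> Q (sem P s) \<Longrightarrow> cost P \<le> T \<Longrightarrow> wp P T Q s"
  using exec_loopfree[of P s] unfolding wp_def by fastforce

lemma wp_mono: "wp P T Q s \<Longrightarrow> T \<le> T' \<Longrightarrow> (\<And>s'. Q s' \<Longrightarrow> Q' s') \<Longrightarrow> wp P T' Q' s"
  unfolding wp_def by fastforce

lemma wp_Seq: "wp P T Q s \<Longrightarrow> (\<And>s'. Q s' \<Longrightarrow> wp P' T' Q' s') \<Longrightarrow> wp (Seq P P') (T + T') Q' s"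
  unfolding wp_def using exec.Seq add_le_mono by fast

lemma wp_prefix: "wp Q T R (sem P s) \<Longrightarrow> loopfree P \<Longrightarrow> cost P + T \<le> T' \<Longrightarrow> wp (Seq P Q) T' R s"
  by (rule wp_mono[OF wp_Seq[OF wp_loopfree[where Q = "\<lambda>s'. s' = sem P s"]]]) auto

lemma wp_Cond:
  "(bval b s \<Longrightarrow> wp P T Q s) \<Longrightarrow> (\<not> bval b s \<Longrightarrow> wp P' T Q s) \<Longrightarrow> wp (Cond b P P') (T + 1) Q s"
  unfolding wp_def using exec.CondTrue[of b s P _ _ P'] exec.CondFalse[of b s P' _ _ P] add_le_mono1
  by (cases "bval b s") fast+

text \<open>The invariant is indexed by the number of completed iterations, so the index
  \<open>N - i\<close> also serves as the variant and no separate termination argument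
  arises.\<close>

lemma wp_While:
  assumes "\<And>i s. i < N \<Longrightarrow> Inv i s \<Longrightarrow> bval b s \<and> wp P T (Inv (Suc i)) s"
    and "\<And>s. Inv N s \<Longrightarrow> \<not> bval b s"
  shows "i \<le> N \<Longrightarrow> Inv i s \<Longrightarrow> wp (While b P) ((N - i) * (T + 1) + 1) (Inv N) s"
proof (induction "N - i" arbitrary: i s)
  case 0
  then show ?case
    using assms(2) by (auto simp: wp_def intro!: exI[of _ "1::nat"] exI[of _ s] exec.WhileFalse)
next
  case (Suc d)
  then have i: "i < N" by simp
  obtain t s1 where 1: "exec P s t s1" "t \<le> T" "Inv (Suc i) s1" and b: "bval b s"
    using assms(1)[OF i Suc.prems(2)] by (auto simp: wp_def)
  from Suc.hyps(1)[of "Suc i" s1] Suc.hyps(2) i 1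
  obtain u s2 where 2: "exec (While b P) s1 u s2" "u \<le> (N - Suc i) * (T + 1) + 1" "Inv N s2"
    unfolding wp_def by fastforce
  have "N - i = Suc (N - Suc i)" using i by simp
  then have "t + u + 1 \<le> (N - i) * (T + 1) + 1" using 1 2 by simp
  with 1 2 b show ?case unfolding wp_def by (blast intro: exec.WhileTrue)
qed

section \<open>Counting loops, rounding by counting, and frame conditions\<close>

abbreviation iv :: "name \<Rightarrow> iexp" where "iv x \<equiv> IGet x (INum 0) (INum 0)"
abbreviation rv :: "name \<Rightarrow> rexp" where "rv x \<equiv> RGet x (INum 0) (INum 0)"
abbreviation seti :: "name \<Rightarrow> iexp \<Rightarrow> com" where "seti x e \<equiv> ISet x (INum 0) (INum 0) e"
abbreviation setr :: "name \<Rightarrow> rexp \<Rightarrow> com" where "setr x e \<equiv> RSet x (INum 0) (INum 0) e"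
abbreviation Seq' :: "com \<Rightarrow> com \<Rightarrow> com" (infixr \<open>;;\<close> 60) where "P ;; Q \<equiv> Seq P Q"

abbreviation isc :: "state \<Rightarrow> name \<Rightarrow> nat" where "isc s x \<equiv> imem s x 0 0"
abbreviation rsc :: "state \<Rightarrow> name \<Rightarrow> real" where "rsc s x \<equiv> rmem s x 0 0"

definition setx :: "name \<Rightarrow> nat \<Rightarrow> state \<Rightarrow> state" where
  "setx x v s = State (update (imem s) x 0 0 v) (rmem s)"

lemma setx_simps [simp]:
  "rmem (setx x v s) = rmem s"
  "imem (setx x v s) x 0 0 = v"
  "a \<noteq> x \<Longrightarrow> imem (setx x v s) a = imem s a"
  by (simp_all add: setx_def update_def)

definition For :: "name \<Rightarrow> iexp \<Rightarrow> iexp \<Rightarrow> com \<Rightarrow> com" where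
  "For x lo hi P = seti x lo ;; While (ILess (iv x) hi) (P ;; seti x (IAdd (iv x) (INum 1)))"

text \<open>\<open>Inv i\<close> speaks of the state just after the counter became \<open>i\<close>,
  hence the \<open>setx\<close>. The bound is evaluated anew at each test, so it has to be constant
  under the invariant. Each iteration pays for its test and increment; the final \<open>2\<close>
  are the first assignment and the failing test.\<close>

lemma wp_For:
  assumes lo: "ival elo s = lo" "lo \<le> hi"
    and init: "Inv lo (setx x lo s)"
    and body: "\<And>i s. \<lbrakk>lo \<le> i; i < hi; Inv i s; isc s x = i\<rbrakk>
        \<Longrightarrow> wp P T (\<lambda>s'. isc s' x = i \<and> Inv (Suc i) (setx x (Suc i) s')) s"
    and hi: "\<And>i s. Inv i s \<Longrightarrow> ival ehi s = hi"
    and post: "\<And>s'. Inv hi s' \<Longrightarrow> Q s'"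
  shows "wp (For x elo ehi P) ((hi - lo) * (T + 2) + 2) Q s"
proof -
  let ?J = "\<lambda>d s. isc s x = lo + d \<and> Inv (lo + d) s"
  have "wp (While (ILess (iv x) ehi) (P ;; seti x (IAdd (iv x) (INum 1))))
      ((hi - lo - 0) * (Suc T + 1) + 1) (?J (hi - lo)) (setx x lo s)"
  proof (rule wp_While)
    fix i s assume i: "i < hi - lo" and J: "?J i s"
    have "wp (P ;; seti x (IAdd (iv x) (INum 1))) (T + 1) (?J (Suc i)) s"
      by (rule wp_Seq, rule body[of "lo + i"])
        (use i J in \<open>auto intro!: wp_loopfree simp: setx_def update_same\<close>)
    with i J hi[of "lo + i" s] show "bval (ILess (iv x) ehi) s \<and>
        wp (P ;; seti x (IAdd (iv x) (INum 1))) (Suc T) (?J (Suc i)) s"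
      by simp
  next
    fix s assume "?J (hi - lo) s"
    then show "\<not> bval (ILess (iv x) ehi) s"
      using hi[of hi s] lo(2) by simp
  qed (use init in auto)
  then have "wp (For x elo ehi P) (1 + ((hi - lo - 0) * (Suc T + 1) + 1)) (?J (hi - lo)) s"
    unfolding For_def
    by (intro wp_Seq[where Q = "\<lambda>s'. s' = setx x lo s" and T = 1, OF wp_loopfree])
      (use lo in \<open>auto simp: setx_def\<close>)
  then show ?thesis
    by (rule wp_mono) (use post lo in auto)
qed

text \<open>The machine offers no conversion between reals and naturals, so the same number is
  counted up in an integer cell and a real cell, both named \<open>x\<close>. The time is
  proportional to the result; only polynomially bounded values may be rounded this way.\<close>

definition Ceil :: "name \<Rightarrow> rexp \<Rightarrow> com" where
  "Ceil x e = seti x (INum 0) ;; setr x (RNum 0) ;;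
     While (RLess (rv x) e) (seti x (IAdd (iv x) (INum 1)) ;; setr x (RAdd (rv x) (RNum 1)))"

text \<open>Frame condition: at most the integer arrays in \<open>X\<close> and the real arrays in
  \<open>Y\<close> differ.\<close>

definition same :: "name set \<Rightarrow> name set \<Rightarrow> state \<Rightarrow> state \<Rightarrow> bool" where
  "same X Y s s' \<longleftrightarrow> (\<forall>a. a \<notin> X \<longrightarrow> imem s' a = imem s a) \<and> (\<forall>a. a \<notin> Y \<longrightarrow> rmem s' a = rmem s a)"

lemma same_refl [simp]: "same X Y s s"
  by (simp add: same_def)

lemma same_trans:
  assumes "same X Y s s'" "same X' Y' s' s''" "X \<subseteq> Z" "X' \<subseteq> Z" "Y \<subseteq> U" "Y' \<subseteq> U"
  shows "same Z U s s''"
proof -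
  have "imem s'' a = imem s a" if "a \<notin> Z" for a
    using assms that by (metis same_def subsetD)
  moreover have "rmem s'' a = rmem s a" if "a \<notin> U" for a
    using assms that by (metis same_def subsetD)
  ultimately show ?thesis by (simp add: same_def)
qed

lemma same_imem: "same X Y s s' \<Longrightarrow> a \<notin> X \<Longrightarrow> imem s' a = imem s a"
  and same_rmem: "same X Y s s' \<Longrightarrow> a \<notin> Y \<Longrightarrow> rmem s' a = rmem s a"
  by (auto simp: same_def)

lemma same_setx [simp]: "x \<in> X \<Longrightarrow> same X Y s (setx x v s') = same X Y s s'"
  by (auto simp: same_def setx_def update_def)

lemma wp_Ceil:
  assumes e: "\<And>s'. same {x} {x} s s' \<Longrightarrow> rval e s' = z" and N: "N = nat \<lceil>z\<rceil>"
  shows "wp (Ceil x e) (N * 3 + 3) (\<lambda>s'. isc s' x = N \<and> rsc s' x = real N \<and> same {x} {x} s s') s"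
proof -
  \<comment> \<open>The hypothesis on \<open>e\<close> says that the expression does not read the
    two cells being counted, so the target \<open>z\<close> stays fixed during the loop.\<close>
  let ?J = "\<lambda>i s'. isc s' x = i \<and> rsc s' x = real i \<and> same {x} {x} s s'"
  have z: "i < N \<longleftrightarrow> real i < z" for i :: nat
    unfolding N by linarith
  have "wp (While (RLess (rv x) e) (seti x (IAdd (iv x) (INum 1)) ;; setr x (RAdd (rv x) (RNum 1))))
      ((N - 0) * (2 + 1) + 1) (?J N) s1" if "?J 0 s1" for s1
  proof (rule wp_While)
    fix i s' assume "i < N" "?J i s'"
    then show "bval (RLess (rv x) e) s' \<and>
        wp (seti x (IAdd (iv x) (INum 1)) ;; setr x (RAdd (rv x) (RNum 1))) 2 (?J (Suc i)) s'"
      using e[of s'] z[of i] by (auto intro!: wp_loopfree simp: update_same) (auto simp: same_def update_other)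
  next
    fix s' assume "?J N s'"
    then show "\<not> bval (RLess (rv x) e) s'"
      using e[of s'] z[of N] by auto
  qed (use that in auto)
  then have "wp (Ceil x e) (1 + (1 + ((N - 0) * (2 + 1) + 1))) (?J N) s"
    unfolding Ceil_def
    by (intro wp_Seq[where T = 1 and Q = "\<lambda>s'. isc s' x = 0 \<and> same {x} {x} s s'", OF wp_loopfree]
      wp_Seq[where T = 1 and Q = "?J 0", OF wp_loopfree])
      (auto simp: update_same same_def update_other)
  then show ?thesis by (rule wp_mono) auto
qed

lemma same_update [simp]:
  "same X Y s (State (imem s') (rmem s')) = same X Y s s'"
  "a \<in> X \<Longrightarrow> same X Y s (State (update im a i j v) rm) = same X Y s (State im rm)"
  "b \<in> Y \<Longrightarrow> same X Y s (State im (update rm b i j u)) = same X Y s (State im rm)"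
  by (auto simp: same_def update_def)

section \<open>Sparse approximately optimal strategies\<close>

lemma sum_pmf_eq_sum_list:
  fixes f :: "'a \<Rightarrow> real"
  assumes "distinct (map fst L)" "\<And>z. z \<in> set L \<Longrightarrow> pmf x (fst z) = snd z" "finite X"
    "set_pmf x \<subseteq> fst ` set L" "fst ` set L \<subseteq> X"
  shows "(\<Sum>i\<in>X. pmf x i * f i) = (\<Sum>z\<leftarrow>L. snd z * f (fst z))"
proof -
  have "(\<Sum>i\<in>X. pmf x i * f i) = (\<Sum>i\<in>fst ` set L. pmf x i * f i)"
    using assms by (intro sum.mono_neutral_right) (auto simp: set_pmf_eq)
  also have "\<dots> = (\<Sum>z\<in>set L. snd z * f (fst z))"
    using assms by (subst sum.reindex) (auto simp: distinct_map)
  also have "\<dots> = (\<Sum>z\<leftarrow>L. snd z * f (fst z))"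
    using assms by (simp add: sum_list_distinct_conv_sum_set distinct_map)
  finally show ?thesis .
qed

text \<open>A sparse form lists exactly the support, so every listed probability must be positive
  and no strategy may be listed twice; these are the obligations passed on to the program.\<close>

lemma ex_sparse_form:
  fixes L :: "('a \<times> real) list"
  assumes d: "distinct (map fst L)" and pos: "\<And>z. z \<in> set L \<Longrightarrow> 0 < snd z"
    and 1: "sum_list (map snd L) = 1"
  obtains x where "sparse_form L x" "set_pmf x = fst ` set L"
    "\<And>z. z \<in> set L \<Longrightarrow> pmf x (fst z) = snd z"
proof
  let ?x = "pmf_of_list L"
  have wf: "pmf_of_list_wf L"
    using pos 1 by (intro pmf_of_list_wfI) (auto simp: less_imp_le)
  have val: "pmf ?x (fst z) = snd z" if "z \<in> set L" for z
  proof -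
    \<comment> \<open>\<open>pmf_of_list\<close> adds up all entries with the same key; distinct
      keys leave a single one.\<close>
    have "filter (\<lambda>y. fst y = fst z) L = [z]"
      using d that
    proof (induction L)
      case (Cons a L)
      then show ?case
        by (cases "z = a") (auto simp: filter_empty_conv image_iff)
    qed simp
    then show ?thesis
      using pmf_pmf_of_list[OF wf, of "fst z"] by simp
  qed
  show "\<And>z. z \<in> set L \<Longrightarrow> pmf ?x (fst z) = snd z" by (rule val)
  show supp: "set_pmf ?x = fst ` set L"
    using pos by (intro set_pmf_of_list_eq[OF wf]) force
  show "sparse_form L ?x"
  proof -
    have "(i, pmf ?x i) \<in> set L" if "pmf ?x i \<noteq> 0" for i
    proof -
      have "i \<in> fst ` set L"
        using that unfolding supp[symmetric] by (simp add: set_pmf_iff)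
      then obtain z where "z \<in> set L" "i = fst z" by blast
      then show ?thesis using val[of z] by simp
    qed
    moreover have "z \<in> {(i, pmf ?x i) |i. pmf ?x i \<noteq> 0}" if "z \<in> set L" for z
      using val[OF that] pos[OF that] by (cases z) auto
    ultimately show ?thesis
      unfolding sparse_form_def using d by auto
  qed
qed

lemma exp_payoff_sum:
  assumes "finite X" "finite Y" "x \<in> mixed X" "y \<in> mixed Y"
  shows "exp_payoff A x y = (\<Sum>i\<in>X. \<Sum>j\<in>Y. pmf x i * pmf y j * A i j)"
proof -
  have "exp_payoff A x y = (\<Sum>z\<in>X \<times> Y. (case z of (i, j) \<Rightarrow> A i j) * pmf (pair_pmf x y) z)"
    unfolding exp_payoff_def using assms
    by (intro integral_measure_pmf_real) (auto simp: mixed_def)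
  also have "\<dots> = (\<Sum>i\<in>X. \<Sum>j\<in>Y. pmf x i * pmf y j * A i j)"
    by (subst sum.cartesian_product) (auto intro!: sum.cong simp: pmf_pair)
  finally show ?thesis .
qed

lemma sum_pmf_mixed: "finite X \<Longrightarrow> x \<in> mixed X \<Longrightarrow> (\<Sum>i\<in>X. pmf x i) = 1"
  by (simp add: mixed_def sum_pmf_eq_1)

text \<open>Weak duality: the guarantees enclose the value, \<open>l <= V <= u\<close>, so
  \<open>u <= \<alpha> * l\<close> gives both \<open>V / \<alpha> <= l\<close> and
  \<open>u <= \<alpha> * V\<close>. The case \<open>l = u = 0\<close> is included and serves the
  degenerate instances.\<close>

lemma approx_optimal:
  fixes A :: "'a \<Rightarrow> 'b \<Rightarrow> real"
  assumes fin: "finite X" "finite Y"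
    and x: "x \<in> mixed X" and lo: "\<And>j. j \<in> Y \<Longrightarrow> l \<le> (\<Sum>i\<in>X. pmf x i * A i j)"
    and y: "y \<in> mixed Y" and up: "\<And>i. i \<in> X \<Longrightarrow> (\<Sum>j\<in>Y. pmf y j * A i j) \<le> u"
    and lu: "u \<le> \<alpha> * l" and \<alpha>: "0 < \<alpha>"
  shows "optimal_max A X Y \<alpha> x" "optimal_min A X Y \<alpha> y"
proof -
  have L: "l \<le> exp_payoff A x y'" if y': "y' \<in> mixed Y" for y'
  proof -
    have "l = (\<Sum>j\<in>Y. pmf y' j * l)"
      using sum_pmf_mixed[OF fin(2) y'] by (simp flip: sum_distrib_right)
    also have "\<dots> \<le> (\<Sum>j\<in>Y. pmf y' j * (\<Sum>i\<in>X. pmf x i * A i j))"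
      by (intro sum_mono mult_left_mono lo) auto
    also have "\<dots> = exp_payoff A x y'"
      unfolding exp_payoff_sum[OF fin x y'] by (subst sum.swap) (simp add: sum_distrib_left mult_ac)
    finally show ?thesis .
  qed
  have U: "exp_payoff A x' y \<le> u" if x': "x' \<in> mixed X" for x'
  proof -
    have "exp_payoff A x' y = (\<Sum>i\<in>X. pmf x' i * (\<Sum>j\<in>Y. pmf y j * A i j))"
      unfolding exp_payoff_sum[OF fin x' y] by (simp add: sum_distrib_left mult_ac)
    also have "\<dots> \<le> (\<Sum>i\<in>X. pmf x' i * u)"
      by (intro sum_mono mult_left_mono up) auto
    also have "\<dots> = u"
      using sum_pmf_mixed[OF fin(1) x'] by (simp flip: sum_distrib_right)
    finally show ?thesis .
  qed
  \<comment> \<open>A common lower bound of all payoffs: infima of reals can be handled only on sets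
    bounded below.\<close>
  define B where "B = (\<Sum>i\<in>X. \<Sum>j\<in>Y. - \<bar>A i j\<bar>)"
  have bnd: "B \<le> exp_payoff A x' y'" if "x' \<in> mixed X" "y' \<in> mixed Y" for x' y'
    unfolding exp_payoff_sum[OF fin that] B_def
  proof (intro sum_mono)
    fix i j
    have "pmf x' i * pmf y' j * \<bar>A i j\<bar> \<le> 1 * \<bar>A i j\<bar>"
      by (intro mult_right_mono mult_le_one) (auto simp: pmf_le_1)
    then show "- \<bar>A i j\<bar> \<le> pmf x' i * pmf y' j * A i j"
      using abs_ge_minus_self[of "pmf x' i * pmf y' j * A i j"] by (simp add: abs_mult)
  qed
  have inf_le: "(INF y'\<in>mixed Y. exp_payoff A x' y') \<le> u" if "x' \<in> mixed X" for x'
    by (rule cINF_lower2[where x = y]) (use y U[OF that] bnd[OF that] in \<open>auto intro!: bdd_belowI2[of _ B]\<close>)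
  have "l \<le> (INF y'\<in>mixed Y. exp_payoff A x y')"
    by (rule cINF_greatest) (use y L in auto)
  also have "\<dots> \<le> game_value A X Y"
    unfolding game_value_def
    by (rule cSUP_upper[OF x]) (use inf_le in \<open>auto intro!: bdd_aboveI2[of _ _ u]\<close>)
  finally have lV: "l \<le> game_value A X Y" .
  have Vu: "game_value A X Y \<le> u"
    unfolding game_value_def by (rule cSUP_least) (use x inf_le in auto)
  have "game_value A X Y / \<alpha> \<le> l"
    using order_trans[OF Vu lu] \<alpha> by (simp add: field_simps)
  then show "optimal_max A X Y \<alpha> x"
    unfolding optimal_max_def using x L by (auto intro: order_trans)
  have "u \<le> \<alpha> * game_value A X Y"
    by (rule order_trans[OF lu]) (use lV \<alpha> in \<open>simp add: mult_left_mono\<close>)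
  then show "optimal_min A X Y \<alpha> y"
    unfolding optimal_min_def using y U by (auto intro: order_trans)
qed

lemma approx_optimal_lists:
  fixes A :: "'a \<Rightarrow> 'b \<Rightarrow> real"
  assumes fin: "finite X" "finite Y"
    and K: "distinct (map fst K)" "\<And>z. z \<in> set K \<Longrightarrow> 0 < snd z" "sum_list (map snd K) = 1"
      "fst ` set K \<subseteq> X" "\<And>j. j \<in> Y \<Longrightarrow> l \<le> (\<Sum>z\<leftarrow>K. snd z * A (fst z) j)"
    and L: "distinct (map fst L)" "\<And>z. z \<in> set L \<Longrightarrow> 0 < snd z" "sum_list (map snd L) = 1"
      "fst ` set L \<subseteq> Y" "\<And>i. i \<in> X \<Longrightarrow> (\<Sum>z\<leftarrow>L. snd z * A i (fst z)) \<le> u"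
    and lu: "u \<le> \<alpha> * l" and \<alpha>: "0 < \<alpha>"
  shows "\<exists>x y. sparse_form K x \<and> sparse_form L y \<and> optimal_max A X Y \<alpha> x \<and> optimal_min A X Y \<alpha> y"
proof -
  obtain x where x: "sparse_form K x" "set_pmf x = fst ` set K"
      "\<And>z. z \<in> set K \<Longrightarrow> pmf x (fst z) = snd z"
    using ex_sparse_form[OF K(1-3)] by blast
  obtain y where y: "sparse_form L y" "set_pmf y = fst ` set L"
      "\<And>z. z \<in> set L \<Longrightarrow> pmf y (fst z) = snd z"
    using ex_sparse_form[OF L(1-3)] by blast
  have "l \<le> (\<Sum>i\<in>X. pmf x i * A i j)" if "j \<in> Y" for j
    using sum_pmf_eq_sum_list[OF K(1) x(3) fin(1), of "\<lambda>i. A i j"] x(2) K(4,5) that by simp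
  moreover have "(\<Sum>j\<in>Y. pmf y j * A i j) \<le> u" if "i \<in> X" for i
    using sum_pmf_eq_sum_list[OF L(1) y(3) fin(2), of "A i"] y(2) L(4,5) that by simp
  ultimately show ?thesis
    using approx_optimal[OF fin, of x l A y u \<alpha>] x y K(4) L(4) lu \<alpha> by (auto simp: mixed_def)
qed

section \<open>An approximate knapsack oracle\<close>

text \<open>\<open>knap r c k i v\<close> is the least cost of a subset of \<open>{1..i}\<close> with reward at least \<open>v\<close>, where \<open>k + 1\<close>
  stands for infinity. "At least" instead of "exactly" is what makes the truncated \<open>v - r (Suc i)\<close> correct.\<close>

fun knap :: "(nat \<Rightarrow> nat) \<Rightarrow> (nat \<Rightarrow> real) \<Rightarrow> real \<Rightarrow> nat \<Rightarrow> nat \<Rightarrow> real" where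
  "knap r c k 0 v = (if v = 0 then 0 else k + 1)"
| "knap r c k (Suc i) v = min (knap r c k i v) (knap r c k i (v - r (Suc i)) + c (Suc i))"

text \<open>The comparison is strict, so a tie leaves the location out. The backtracking of the
  program uses the same test and therefore recovers exactly this set.\<close>

fun picks :: "(nat \<Rightarrow> nat) \<Rightarrow> (nat \<Rightarrow> real) \<Rightarrow> real \<Rightarrow> nat \<Rightarrow> nat \<Rightarrow> nat set" where
  "picks r c k 0 v = {}"
| "picks r c k (Suc i) v = (if knap r c k (Suc i) v < knap r c k i v
     then insert (Suc i) (picks r c k i (v - r (Suc i))) else picks r c k i v)"

text \<open>Induction on \<open>i\<close>, splitting on whether the last location lies in
  \<open>S\<close>; if so, it is removed, and truncated subtraction lowers the requirement by its
  reward.\<close>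

lemma knap_le: "S \<subseteq> {1..i} \<Longrightarrow> v \<le> sum r S \<Longrightarrow> knap r c k i v \<le> sum c S"
proof (induction i arbitrary: S v)
  case (Suc i)
  have fin: "finite S" using Suc.prems finite_subset by blast
  show ?case
  proof (cases "Suc i \<in> S")
    case True
    have "S - {Suc i} \<subseteq> {1..i}" using Suc.prems by force
    moreover have "sum r S = r (Suc i) + sum r (S - {Suc i})" "sum c S = c (Suc i) + sum c (S - {Suc i})"
      by (rule sum.remove[OF fin True])+
    ultimately have "knap r c k i (v - r (Suc i)) + c (Suc i) \<le> sum c S"
      using Suc.IH[of "S - {Suc i}" "v - r (Suc i)"] Suc.prems(2) by simp
    then show ?thesis by (simp add: min.coboundedI2)
  next
    case False
    then have "S \<subseteq> {1..i}" using Suc.prems(1) by (simp add: atLeastAtMostSuc_conv subset_insert)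
    then show ?thesis using Suc.IH[of S v] Suc.prems(2) by (simp add: min.coboundedI1)
  qed
qed auto

lemma picks_subset: "picks r c k i v \<subseteq> {1..i}"
proof (induction i arbitrary: v)
  case (Suc i)
  have "{1..i} \<subseteq> {1..Suc i}" by simp
  then show ?case
    using Suc[of v] Suc[of "v - r (Suc i)"] by (auto simp del: knap.simps)
qed simp

lemma finite_picks [simp]: "finite (picks r c k i v)"
  by (rule finite_subset[OF picks_subset]) simp

text \<open>\<open>knap r c k i v <= k\<close> rules out the value \<open>k + 1\<close> for
  infinity, and nonnegative costs pass this condition down the recursion.\<close>

lemma picks_correct:
  assumes "\<And>j. j \<in> {1..i} \<Longrightarrow> 0 \<le> c j" "knap r c k i v \<le> k"
  shows "sum c (picks r c k i v) = knap r c k i v \<and> v \<le> sum r (picks r c k i v)"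
  using assms
proof (induction i arbitrary: v)
  case (Suc i)
  show ?case
  proof (cases "knap r c k (Suc i) v < knap r c k i v")
    case True
    then have eq: "knap r c k (Suc i) v = knap r c k i (v - r (Suc i)) + c (Suc i)"
      by (auto simp: min_def split: if_splits)
    have "Suc i \<notin> picks r c k i (v - r (Suc i))"
      using picks_subset[of r c k i "v - r (Suc i)"] by auto
    moreover have "knap r c k i (v - r (Suc i)) \<le> k"
      using eq Suc.prems(1)[of "Suc i"] Suc.prems(2) by simp
    ultimately show ?thesis
      using Suc.IH[of "v - r (Suc i)"] Suc.prems(1) True eq by auto
  next
    case False
    then have "knap r c k (Suc i) v = knap r c k i v" by (simp add: min_def split: if_splits)
    with False show ?thesis using Suc by auto
  qed
qed (auto split: if_splits)

text \<open>Rewards are rounded up to multiples of \<open>vm / (n R)\<close>. A set has at most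
  \<open>n\<close> members, so rounding errs by at most \<open>vm / R\<close> in total, and the
  singleton \<open>{i0}\<close> is feasible with reward \<open>vm\<close>, which makes this a
  relative error. Rounded rewards are at most \<open>n R\<close> each, so totals up to
  \<open>n * n * R\<close> are enough.\<close>

lemma knap_oracle:
  fixes v :: "nat \<Rightarrow> real"
  assumes v: "\<And>j. j \<in> {1..n} \<Longrightarrow> 0 < v j \<and> v j \<le> vm" and vm: "0 < vm"
    and i0: "i0 \<in> {1..n}" "v i0 = vm" and c: "\<And>j. j \<in> {1..n} \<Longrightarrow> 0 \<le> c j \<and> c j \<le> k"
    and R: "0 < R" and r: "\<And>j. r j = nat \<lceil>v j * (real n * real R) / vm\<rceil>"
    and b: "knap r c k n b \<le> k" "\<And>b'. knap r c k n b' \<le> k \<Longrightarrow> b' \<le> n * n * R \<Longrightarrow> b' \<le> b"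
    and S: "S \<subseteq> {1..n}" "sum c S \<le> k"
  shows "(1 - 1 / R) * sum v S \<le> sum v (picks r c k n b)"
proof -
  define q where "q = vm / (real n * real R)"
  define P where "P = picks r c k n b"
  have n: "0 < n" using i0 by auto
  have q: "0 < q" using n vm R by (simp add: q_def)
  have r_eq: "real (r j) = of_int \<lceil>v j / q\<rceil>" if "j \<in> {1..n}" for j
    using v[OF that] q vm R n by (simp add: r q_def)
  have rlo: "v j \<le> q * r j" and rhi: "q * r j \<le> v j + q" if "j \<in> {1..n}" for j
  proof -
    have "v j / q \<le> r j" "r j \<le> v j / q + 1"
      unfolding r_eq[OF that] by linarith+
    then show "v j \<le> q * r j" "q * r j \<le> v j + q"
      using q by (simp_all add: field_simps)
  qed
  have rK: "r j \<le> n * R" if "j \<in> {1..n}" for j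
  proof -
    have "v j * (real n * real R) / vm \<le> real (n * R)"
      using v[OF that] vm mult_right_mono[of "v j" vm "real n * real R"] by (simp add: field_simps)
    then show ?thesis unfolding r by linarith
  qed
  have P: "P \<subseteq> {1..n}" "b \<le> sum r P" and finP: "finite P"
    using picks_subset[of r c k n b] picks_correct[of n c r k b] b c by (auto simp: P_def)
  have main: "sum v S' \<le> sum v P + vm / R" if S': "S' \<subseteq> {1..n}" "sum c S' \<le> k" for S'
  proof -
    have "sum r S' \<le> (\<Sum>j\<in>S'. n * R)"
      using S' rK by (intro sum_mono) auto
    also have "\<dots> \<le> n * n * R"
      using card_mono[OF _ S'(1)] by (simp add: mult.assoc)
    finally have "sum r S' \<le> b"
      using b(2) knap_le[OF S'(1) order_refl, of r c k] S'(2) by auto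
    then have *: "real (sum r S') \<le> real (sum r P)" using P(2) of_nat_mono order_trans by blast
    have "sum v S' \<le> (\<Sum>j\<in>S'. q * r j)"
      using S' rlo by (intro sum_mono) auto
    also have "\<dots> = q * real (sum r S')" by (simp add: sum_distrib_left)
    also have "\<dots> \<le> q * real (sum r P)" using * q by (simp add: mult_left_mono)
    also have "\<dots> = (\<Sum>j\<in>P. q * r j)" by (simp add: sum_distrib_left)
    also have "\<dots> \<le> (\<Sum>j\<in>P. v j + q)"
      using P rhi by (intro sum_mono) auto
    also have "\<dots> = sum v P + card P * q" by (simp add: sum.distrib)
    also have "card P * q \<le> n * q"
      using card_mono[OF _ P(1)] q by (simp add: mult_right_mono)
    also have "n * q = vm / R" using n by (simp add: q_def)
    finally show ?thesis by simp
  qed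
  have R1: "0 \<le> 1 - 1 / real R" using R by (simp add: field_simps)
  have "vm \<le> sum v P + vm / R"
    using main[of "{i0}"] i0 c by simp
  then have vmP: "(1 - 1 / R) * vm \<le> sum v P" by (simp add: algebra_simps)
  \<comment> \<open>\<open>S\<close> is arbitrary and may be worth less than \<open>vm\<close>; then
    the comparison with \<open>{i0}\<close> suffices. Otherwise \<open>vm / R\<close> is at most the
    fraction \<open>1/R\<close> of the reward of \<open>S\<close>.\<close>
  have "(1 - 1 / R) * sum v S \<le> sum v P"
  proof (cases "sum v S \<le> vm")
    case True
    then show ?thesis using vmP mult_left_mono[OF True R1] by linarith
  next
    case False
    then have "vm / R \<le> sum v S / R" using R by (simp add: divide_right_mono)
    then show ?thesis using main[OF S] by (simp add: algebra_simps)
  qed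
  then show ?thesis by (simp add: P_def)
qed

section \<open>Multiplicative weights\<close>

text \<open>The quadratic term here is the origin of all later factors
  \<open>1 + 2h\<close>.\<close>

lemma exp_le_one_minus:
  fixes x :: real
  assumes "0 \<le> x" "x \<le> 1 / 2"
  shows "exp (- x - 2 * x\<^sup>2) \<le> 1 - x"
  using ln_one_minus_pos_lower_bound[OF assms] assms
  by (metis diff_gt_0_iff_gt exp_le_cancel_iff exp_ln field_sum_of_halves less_add_same_cancel1
      half_gt_zero_iff order_le_less_trans zero_less_one)

text \<open>The nondegenerate instances: demands \<open>1 / p j\<close> are finite and every single
  location can be searched. \<open>R >= 8\<close> means \<open>h <= 1/8\<close> for the step size
  \<open>h = 1/R\<close>, which all numerical estimates below rely on.\<close>

locale hspe_game =
  fixes n :: nat and c p :: "nat \<Rightarrow> real" and k :: real and R :: nat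
  assumes n: "1 \<le> n" and R: "8 \<le> R"
    and c: "\<And>j. j \<in> {1..n} \<Longrightarrow> 0 \<le> c j \<and> c j \<le> k"
    and p: "\<And>j. j \<in> {1..n} \<Longrightarrow> 0 < p j"
begin

text \<open>With \<open>1 / m j = 1 + 1 / (a * p j)\<close> the demand \<open>1 / p j\<close> of location \<open>j\<close>, the reciprocal of its capture
  probability, is increased to \<open>1 / p j + a\<close> and rescaled by \<open>a\<close>. This bounds all payoffs \<open>m j\<close> by 1, while
  the value of the modified game is at least of order \<open>1 / (n\<^sup>2 * R)\<close>.\<close>

definition a :: real where
  "a = (\<Sum>j=1..n. 1 / p j) / (real n * real n * real R)"

definition m :: "nat \<Rightarrow> real" where
  "m j = a * p j / (1 + a * p j)"

definition feasible :: "nat set \<Rightarrow> bool" where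
  "feasible S \<longleftrightarrow> S \<subseteq> {1..n} \<and> sum c S \<le> k"

text \<open>The total payoff after \<open>T\<close> rounds is at least
  \<open>(7/9) T / (n^2 R)\<close>; this choice of \<open>T\<close> makes it exceed
  \<open>n R^2\<close>, which is \<open>R\<close> times the regret bound \<open>n R\<close>.\<close>

definition rounds :: nat where
  "rounds = 4 * (n * R) ^ 3"

lemma rounds_pos: "0 < real rounds"
  using n R by (simp add: rounds_def)

text \<open>After \<open>t\<close> rounds, \<open>w\<close> are the weights, \<open>g j\<close> counts the rounds whose set contained \<open>j\<close>, \<open>C\<close> is the
  total payoff, in the modified game, of the chosen sets against the normalized weights, and \<open>H\<close> is the
  sum of the normalized weights times \<open>m j / p j\<close>, which translates them back to the original game.\<close>

definition mwu_inv :: "real \<Rightarrow> (nat \<Rightarrow> real) \<Rightarrow> (nat \<Rightarrow> real) \<Rightarrow> (nat \<Rightarrow> real) \<Rightarrow> real \<Rightarrow> bool" where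
  "mwu_inv t w H g C \<longleftrightarrow>
     (\<forall>j\<in>{1..n}. exp (- ((1 / R + 2 * (1 / R)\<^sup>2) * (m j * g j))) \<le> w j) \<and>
     sum w {1..n} \<le> n * exp (- (C / R)) \<and>
     (\<forall>S. feasible S \<longrightarrow> (1 - 1 / R) * (\<Sum>j\<in>S. p j * H j) \<le> C) \<and>
     sum H {1..n} + a * (\<Sum>j=1..n. p j * H j) = a * t \<and>
     (\<forall>j\<in>{1..n}. 0 \<le> g j \<and> g j \<le> t \<and> 0 \<le> H j \<and> (0 < t \<longrightarrow> 0 < H j))"

lemma p_nonzero: "Suc 0 \<le> j \<Longrightarrow> j \<le> n \<Longrightarrow> p j \<noteq> 0"
  using p[of j] by simp

lemma a_pos: "0 < a"
proof -
  have "0 < (\<Sum>j=1..n. 1 / p j)"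
    using n p by (intro sum_pos) auto
  then show ?thesis using n R by (simp add: a_def)
qed

lemma m_bounds: "j \<in> {1..n} \<Longrightarrow> 0 < m j \<and> m j < 1"
  using mult_pos_pos[OF a_pos p[of j]] by (simp add: m_def)

lemma m_fold: "a * p j / (1 + a * p j) = m j"
  by (simp add: m_def)

lemma feasible_single: "j \<in> {1..n} \<Longrightarrow> feasible {j}"
  using c by (simp add: feasible_def)

lemma mwu_inv_init: "mwu_inv 0 (\<lambda>_. 1) (\<lambda>_. 0) (\<lambda>_. 0) 0"
  by (simp add: mwu_inv_def)

text \<open>The standard potential argument: \<open>S\<close> shrinks the total weight by the factor
  \<open>1 - M/(W R)\<close>, while a single weight falls by no more than the exponential in the
  lower bound. The oracle guarantee for \<open>S\<close> makes \<open>C\<close> dominate, up to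
  \<open>1 - 1/R\<close>, what any fixed feasible set would have collected.\<close>

lemma mwu_step:
  assumes inv: "mwu_inv t w H g C" and t: "0 \<le> t"
    and S: "S \<subseteq> {1..n}" "\<And>S'. feasible S' \<Longrightarrow>
        (1 - 1 / R) * (\<Sum>j\<in>S'. w j * m j) \<le> (\<Sum>j\<in>S. w j * m j)"
  shows "mwu_inv (t + 1) (\<lambda>j. if j \<in> S then w j - w j * m j / R else w j)
    (\<lambda>j. H j + w j / sum w {1..n} * (m j / p j)) (\<lambda>j. g j + (if j \<in> S then 1 else 0))
    (C + (\<Sum>j\<in>S. w j * m j) / sum w {1..n})"
proof -
  let ?W = "sum w {1..n}" and ?M = "\<Sum>j\<in>S. w j * m j"
  have w: "0 < w j" if "j \<in> {1..n}" for j
    using inv that unfolding mwu_inv_def by (meson exp_gt_zero less_le_trans)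
  have W: "0 < ?W" using n w by (intro sum_pos) auto
  have R0: "0 < real R" using R by simp
  have fin: "finite S" using S(1) finite_subset by blast
  have w': "exp (- ((1 / R + 2 * (1 / R)\<^sup>2) * (m j * (g j + (if j \<in> S then 1 else 0)))))
      \<le> (if j \<in> S then w j - w j * m j / R else w j)" if j: "j \<in> {1..n}" for j
  proof (cases "j \<in> S")
    case True
    have mj: "0 < m j" "m j < 1" using m_bounds[OF j] by auto
    have "m j / R \<le> 1 / 2" using mj R by (simp add: field_simps)
    then have "exp (- (m j / R) - 2 * (m j / R)\<^sup>2) \<le> 1 - m j / R"
      using mj by (intro exp_le_one_minus) auto
    \<comment> \<open>\<open>m j < 1\<close> trades a square for a first power, so that the exponent
      stays proportional to \<open>m j * g j\<close>.\<close>
    moreover have "(m j / R)\<^sup>2 \<le> (1 / R)\<^sup>2 * m j"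
      using mj R0 by (simp add: power2_eq_square field_simps)
    ultimately have 1: "exp (- ((1 / R + 2 * (1 / R)\<^sup>2) * m j)) \<le> 1 - m j / R"
      by (smt (verit, best) distrib_right divide_inverse exp_le_cancel_iff inverse_eq_divide mult.assoc mult.commute mult_1)
    have "exp (- ((1 / R + 2 * (1 / R)\<^sup>2) * (m j * (g j + 1))))
        = exp (- ((1 / R + 2 * (1 / R)\<^sup>2) * (m j * g j))) * exp (- ((1 / R + 2 * (1 / R)\<^sup>2) * m j))"
      unfolding exp_add[symmetric] by (simp add: algebra_simps)
    also have "\<dots> \<le> w j * (1 - m j / R)"
      using inv j 1 w[OF j] by (intro mult_mono) (auto simp: mwu_inv_def)
    finally show ?thesis using True by (simp add: algebra_simps)
  next
    case False
    then show ?thesis using inv j by (simp add: mwu_inv_def)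
  qed
  have "(\<Sum>j=1..n. if j \<in> S then w j - w j * m j / R else w j)
      = (\<Sum>j=1..n. w j - (if j \<in> S then w j * m j / R else 0))"
    by (intro sum.cong) auto
  also have "\<dots> = ?W - (\<Sum>j\<in>S. w j * m j / R)"
    using S(1) by (simp add: sum_subtractf sum.If_cases Int_absorb1)
  also have "\<dots> = ?W * (1 - ?M / ?W / R)"
    using W by (simp add: right_diff_distrib flip: sum_divide_distrib)
  also have "\<dots> \<le> ?W * exp (- (?M / ?W / R))"
    using exp_ge_add_one_self[of "- (?M / ?W / R)"] W by (intro mult_left_mono) auto
  also have "\<dots> \<le> n * exp (- (C / R)) * exp (- (?M / ?W / R))"
    using inv by (intro mult_right_mono) (auto simp: mwu_inv_def)
  also have "\<dots> = n * exp (- ((C + ?M / ?W) / R))"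
    by (simp add: add_divide_distrib exp_add exp_diff exp_minus field_simps)
  finally have W': "(\<Sum>j=1..n. if j \<in> S then w j - w j * m j / R else w j) \<le> \<dots>" .
  \<comment> \<open>The second equation is \<open>m j * (1 / p j + a) = a\<close>:
    \<open>m j / a\<close> is the reciprocal of the increased demand.\<close>
  have pm: "p j * (m j / p j) = m j" "m j / p j + a * m j = a" if "j \<in> {1..n}" for j
  proof -
    show "p j * (m j / p j) = m j" using p[OF that] by simp
    have "0 < 1 + a * p j" using mult_pos_pos[OF a_pos p[OF that]] by simp
    then have "a / (1 + a * p j) * (1 + a * p j) = a" by simp
    moreover have "m j / p j = a / (1 + a * p j)"
      using p[OF that] by (simp add: m_def)
    ultimately show "m j / p j + a * m j = a"
      by (simp add: m_def add_divide_distrib distrib_left mult_ac)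
  qed
  have pH: "(\<Sum>j\<in>S'. p j * (H j + w j / ?W * (m j / p j)))
      = (\<Sum>j\<in>S'. p j * H j) + (\<Sum>j\<in>S'. w j * m j) / ?W" if "S' \<subseteq> {1..n}" for S'
  proof -
    have "(\<Sum>j\<in>S'. p j * (H j + w j / ?W * (m j / p j))) = (\<Sum>j\<in>S'. p j * H j + w j * m j / ?W)"
    proof (intro sum.cong refl)
      fix j assume "j \<in> S'"
      then have "j \<in> {1..n}" using that by blast
      then show "p j * (H j + w j / ?W * (m j / p j)) = p j * H j + w j * m j / ?W"
        using p_nonzero by (simp add: distrib_left)
    qed
    then show ?thesis by (simp add: sum.distrib sum_divide_distrib)
  qed
  have C': "(1 - 1 / R) * (\<Sum>j\<in>S'. p j * (H j + w j / ?W * (m j / p j))) \<le> C + ?M / ?W"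
    if "feasible S'" for S'
  proof -
    have "(1 - 1 / R) * (\<Sum>j\<in>S'. p j * H j) \<le> C" using inv that by (simp add: mwu_inv_def)
    moreover have "(1 - 1 / R) * (\<Sum>j\<in>S'. w j * m j) / ?W \<le> ?M / ?W"
      using S(2)[OF that] W by (simp add: divide_right_mono)
    ultimately show ?thesis
      using that by (subst pH) (auto simp: feasible_def distrib_left)
  qed
  \<comment> \<open>The normalized weights sum to 1, so by the demand identity every round
    contributes exactly \<open>a\<close>.\<close>
  have "(\<Sum>j=1..n. w j / ?W * (m j / p j)) + a * (\<Sum>j=1..n. w j * m j) / ?W
      = (\<Sum>j=1..n. w j / ?W * (m j / p j + a * m j))"
    by (simp add: sum.distrib sum_distrib_left sum_divide_distrib distrib_left mult_ac)
  also have "\<dots> = (\<Sum>j=1..n. w j / ?W * a)"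
    using pm(2) by (intro sum.cong) auto
  also have "\<dots> = a"
    using W by (simp flip: sum_distrib_right sum_divide_distrib)
  finally have "(\<Sum>j=1..n. w j / ?W * (m j / p j)) + a * (\<Sum>j=1..n. w j * m j) / ?W = a" .
  then have eq: "(\<Sum>j=1..n. H j + w j / ?W * (m j / p j))
      + a * (\<Sum>j=1..n. p j * (H j + w j / ?W * (m j / p j))) = a * (t + 1)"
    using inv by (subst pH) (auto simp: mwu_inv_def sum.distrib algebra_simps)
  \<comment> \<open>Strict positivity of the \<open>H j\<close> is carried along because the Hider's
    output must have no zero entry.\<close>
  have "0 < w j / ?W * (m j / p j)" if "j \<in> {1..n}" for j
    using w[OF that] W m_bounds[OF that] p[OF that] by simp
  then have rest: "\<forall>j\<in>{1..n}. 0 \<le> g j + (if j \<in> S then 1 else 0) \<and>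
      g j + (if j \<in> S then 1 else 0) \<le> t + 1 \<and> 0 \<le> H j + w j / ?W * (m j / p j) \<and>
      (0 < t + 1 \<longrightarrow> 0 < H j + w j / ?W * (m j / p j))"
    using inv t unfolding mwu_inv_def by (smt (verit))
  show ?thesis
    unfolding mwu_inv_def using w' W' C' eq rest by blast
qed

text \<open>Compares both guarantees in the original game with the single quantity
  \<open>C / (a T)\<close>: the Hider's payoff is at most slightly above it, the Searcher's at least
  slightly below it.\<close>

lemma mwu_final:
  assumes inv: "mwu_inv rounds w H g C" and S: "feasible S" and j: "j \<in> {1..n}"
    and \<epsilon>: "0 < \<epsilon>" "8 + 8 / \<epsilon> \<le> R"
  shows "(\<Sum>i\<in>S. p i * H i / sum H {1..n}) \<le> (1 + \<epsilon>) * (p j * g j / rounds)"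
proof -
  define h where "h = 1 / real R"
  define T where "T = real rounds"
  define N where "N = sum H {1..n}"
  have R0: "0 < real R" "1 \<le> real n" using R n by auto
  have h: "0 < h" "h \<le> 1 / 8" "h * R = 1" using R by (auto simp: h_def field_simps)
  have T: "T = 4 * (n * R) ^ 3" "0 < T" using R0 by (simp_all add: T_def rounds_def)
  have D: "(\<Sum>j=1..n. 1 / p j) = a * (real n * real n * real R)"
    using R0 by (simp add: a_def)
  have H: "0 \<le> H i" "0 \<le> g i" "g i \<le> T" if "i \<in> {1..n}" for i
    using inv that by (auto simp: mwu_inv_def T_def)
  have feas: "(1 - h) * (\<Sum>i\<in>S'. p i * H i) \<le> C" if "feasible S'" for S'
    using inv that by (simp add: mwu_inv_def h_def)
  have single: "(1 - h) * (p i * H i) \<le> C" if "i \<in> {1..n}" for i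
    using feas[OF feasible_single[OF that]] by simp
  have NT: "N + a * (\<Sum>j=1..n. p j * H j) = a * T"
    using inv by (simp add: mwu_inv_def N_def T_def)
  \<comment> \<open>The regret bound: one weight is at most the total weight, and logarithms of the
    two invariant bounds are compared.\<close>
  have G: "C \<le> n * real R + (1 + 2 * h) * (m i * g i)" if i: "i \<in> {1..n}" for i
  proof -
    have w: "0 \<le> w j" if "j \<in> {1..n}" for j
      using inv that unfolding mwu_inv_def by (meson exp_ge_zero order_trans)
    have "exp (- ((h + 2 * h\<^sup>2) * (m i * g i))) \<le> w i"
      using inv i by (simp add: mwu_inv_def h_def)
    also have "\<dots> \<le> sum w {1..n}"
      using i w by (intro member_le_sum) auto
    also have "\<dots> \<le> n * exp (- (C * h))"
      using inv by (simp add: mwu_inv_def h_def)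
    \<comment> \<open>A generous bound in place of \<open>ln n\<close>; it costs only a polynomial
      factor in the number of rounds.\<close>
    also have "\<dots> \<le> exp n * exp (- (C * h))"
      by (intro mult_right_mono less_imp_le[OF exp_gt_self]) auto
    finally have "- ((h + 2 * h\<^sup>2) * (m i * g i)) \<le> n - C * h"
      by (simp flip: exp_add)
    moreover have "h * (n * real R) = n" using h(3) by (simp add: mult_ac)
    moreover have "h * ((1 + 2 * h) * (m i * g i)) = (h + 2 * h\<^sup>2) * (m i * g i)"
      by (simp add: algebra_simps power2_eq_square)
    ultimately have "h * C \<le> h * (n * real R + (1 + 2 * h) * (m i * g i))"
      by (simp only: distrib_left) (simp add: mult.commute[of h C])
    then show ?thesis using h by simp
  qed
  \<comment> \<open>Lower bound on \<open>C\<close>: averaging the singletons with weights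
    \<open>1 / p i + a\<close>, the increased demands, makes the invariant on \<open>H\<close>
    appear.\<close>
  have "(1 - h) * (a * T) = (\<Sum>i=1..n. (1 / p i + a) * ((1 - h) * (p i * H i)))"
  proof -
    have "(\<Sum>i=1..n. (1 / p i + a) * ((1 - h) * (p i * H i)))
        = (\<Sum>i=1..n. (1 - h) * (H i + a * (p i * H i)))"
      using p_nonzero by (intro sum.cong) (auto simp: field_simps)
    then show ?thesis
      unfolding NT[symmetric] N_def by (simp add: sum.distrib sum_distrib_left[symmetric])
  qed
  also have "\<dots> \<le> (\<Sum>i=1..n. (1 / p i + a) * C)"
    using single p a_pos by (intro sum_mono mult_left_mono) (auto simp: less_imp_le add_nonneg_nonneg)
  also have "\<dots> = a * ((real n * real n * real R + n) * C)"
    unfolding sum_distrib_right[symmetric] sum.distrib D by (simp add: algebra_simps)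
  finally have Clo: "(1 - h) * T \<le> (real n * real n * real R + n) * C"
    using a_pos by (simp add: mult.left_commute)
  define X where "X = real n * real n * real R"
  have X: "0 < X" using R0 by (simp add: X_def)
  have nX: "n * 8 \<le> X"
  proof -
    have "n * 8 \<le> n * (n * R)" using n R mult_le_mono[of 1 n 8 R] by (intro mult_left_mono) auto
    then show ?thesis unfolding X_def by (metis mult.assoc of_nat_le_iff of_nat_mult of_nat_numeral)
  qed
  have "0 < (1 - h) * T" using h T by simp
  then have "0 < (real n * real n * real R + n) * C" using Clo by linarith
  moreover have "0 < real n * real n * real R + n" using R0 by (intro add_pos_pos mult_pos_pos) auto
  ultimately have C: "0 < C" using zero_less_mult_pos by blast
  \<comment> \<open>The constants: \<open>1 - h >= 7/8\<close>, \<open>X + n <= 9/8 * X\<close>, and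
    \<open>T = 4 * n * R^2 * X\<close>. They give \<open>C >= 28/9 * n * R^2\<close>, more than the
    \<open>n * R^2\<close> needed.\<close>
  have "7 / 2 * (n * (real R)\<^sup>2) * X = 7 / 8 * T"
    by (simp add: T X_def power2_eq_square power3_eq_cube)
  also have "\<dots> \<le> (1 - h) * T" using h T by (intro mult_right_mono) auto
  also have "\<dots> \<le> (X + n) * C" using Clo by (simp add: X_def)
  also have "\<dots> \<le> (9 / 8 * X) * C" using nX C by (intro mult_right_mono) auto
  finally have "7 / 2 * (n * (real R)\<^sup>2) * X \<le> (9 / 8 * C) * X" by (simp add: mult_ac)
  then have "7 / 2 * (n * (real R)\<^sup>2) \<le> 9 / 8 * C" using X by (simp only: mult_le_cancel_right_pos)
  moreover have "0 \<le> n * (real R)\<^sup>2" by simp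
  ultimately have "h * (n * (real R)\<^sup>2) \<le> h * C" using h by (intro mult_left_mono) linarith+
  moreover have "h * (n * (real R)\<^sup>2) = (h * R) * (n * R)" by (simp add: power2_eq_square)
  ultimately have nR: "n * real R \<le> h * C" by (simp add: h(3))
  \<comment> \<open>The regret \<open>n R\<close> is now absorbed into a fraction \<open>h\<close>
    of \<open>C\<close>.\<close>
  have CG: "(1 - h) * C \<le> (1 + 2 * h) * (m i * g i)" if "i \<in> {1..n}" for i
    using G[OF that] nR by (simp add: algebra_simps)
  \<comment> \<open>Upper bound on \<open>C\<close>: dividing \<open>CG\<close> by
    \<open>m i\<close> and summing over all locations, with \<open>g i <= T\<close>, confronts
    \<open>C\<close> with the total demand \<open>X + n\<close>.\<close>
  have "(1 - h) * C * X \<le> (1 - h) * C * (X + n)"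
    using h C by (intro mult_left_mono) auto
  also have "X + n = (\<Sum>i=1..n. 1 / m i)"
  proof -
    have "(\<Sum>i=1..n. 1 / m i) = (\<Sum>i=1..n. 1 + 1 / p i / a)"
      using p a_pos by (intro sum.cong) (force simp: m_def field_simps)+
    also have "\<dots> = n + (\<Sum>i=1..n. 1 / p i) / a"
      by (simp only: sum.distrib sum_divide_distrib) simp
    finally show ?thesis unfolding D using a_pos by (simp add: X_def)
  qed
  also have "(1 - h) * C * (\<Sum>i=1..n. 1 / m i) = (\<Sum>i=1..n. (1 - h) * C / m i)"
    by (simp add: sum_distrib_left)
  also have "\<dots> \<le> (\<Sum>i=1..n. (1 + 2 * h) * T)"
  proof (rule sum_mono)
    fix i assume i: "i \<in> {1..n}"
    have "(1 - h) * C / m i \<le> (1 + 2 * h) * g i"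
      using CG[OF i] m_bounds[OF i] by (simp add: field_simps)
    also have "\<dots> \<le> (1 + 2 * h) * T" using H[OF i] h by (intro mult_left_mono) auto
    finally show "(1 - h) * C / m i \<le> (1 + 2 * h) * T" .
  qed
  also have "\<dots> = n * ((1 + 2 * h) * T)" by simp
  finally have "n * ((1 - h) * C * n * R) \<le> n * ((1 + 2 * h) * T)"
    by (simp add: X_def mult_ac)
  then have "(1 - h) * C * n * R \<le> (1 + 2 * h) * T"
    using R0 by simp
  then have "h * ((1 - h) * C * n * R) \<le> h * ((1 + 2 * h) * T)"
    using h by (intro mult_left_mono) auto
  also have "h * ((1 - h) * C * n * R) = (1 - h) * (n * C)" using h(3) by (simp add: mult_ac)
  also have "h * ((1 + 2 * h) * T) \<le> (1 - h) * (2 * h * ((1 - h) * T))"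
  proof -
    \<comment> \<open>This polynomial is the difference of the two sides, divided into factors;
      \<open>h <= 1/8\<close> makes the last one positive.\<close>
    have "0 \<le> h * T * (1 - 6 * h + 2 * h\<^sup>2)" using h T by (intro mult_nonneg_nonneg) auto
    then show ?thesis by (simp add: algebra_simps power2_eq_square)
  qed
  finally have nC: "n * C \<le> 2 * h * ((1 - h) * T)" using h by simp
  have "(1 - h) * (\<Sum>j=1..n. p j * H j) \<le> n * C"
    using sum_bounded_above[of "{1..n}" "\<lambda>i. (1 - h) * (p i * H i)" C] single
    by (simp add: sum_distrib_left)
  with nC have "(1 - h) * (\<Sum>j=1..n. p j * H j) \<le> (1 - h) * (2 * h * T)"
    by (simp add: mult_ac)
  then have "(\<Sum>j=1..n. p j * H j) \<le> 2 * h * T"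
    using h by simp
  \<comment> \<open>The added demand takes at most the fraction \<open>2h\<close> of the Hider's
    normalizer. The value chosen for \<open>a\<close> is small enough for this, yet large enough for
    the lower bound on \<open>C\<close>.\<close>
  then have N: "a * T * (1 - 2 * h) \<le> N"
  proof -
    have "a * (\<Sum>j=1..n. p j * H j) \<le> a * (2 * h * T)"
      using \<open>(\<Sum>j=1..n. p j * H j) \<le> 2 * h * T\<close> a_pos by (intro mult_left_mono) auto
    moreover have "a * T * (1 - 2 * h) = a * T - a * (2 * h * T)" by (simp add: algebra_simps)
    ultimately show ?thesis using NT by linarith
  qed
  have "0 < a * T * (1 - 2 * h)" using a_pos T h by simp
  then have N0: "0 < N" using N by linarith
  \<comment> \<open>The increase of demands only lowers payoffs, so the Searcher's guarantee
    survives the return to the original game.\<close>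
  have am: "m j \<le> a * p j"
    using mult_pos_pos[OF a_pos p[OF j]] divide_left_mono[of 1 "1 + a * p j" "a * p j"] by (simp add: m_def)
  have "(1 - h) * C \<le> (1 + 2 * h) * (a * p j * g j)"
    using CG[OF j] mult_right_mono[OF am H(2)[OF j]] h
    by (smt (verit) mult_left_mono)
  then have lo: "(1 - h) / (1 + 2 * h) * (C / (a * T)) \<le> p j * g j / T"
  proof -
    have "0 < (1 + 2 * h) * (a * T)" using h a_pos T(2) by simp
    moreover have "p j * g j / T * ((1 + 2 * h) * (a * T)) = (1 + 2 * h) * (a * p j * g j)"
      using T(2) by simp
    ultimately show ?thesis
      using \<open>(1 - h) * C \<le> _\<close> unfolding times_divide_times_eq by (simp only: pos_divide_le_eq)
  qed
  define Q where "Q = C / (a * T)"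
  have Q: "0 < Q" using C a_pos T by (simp add: Q_def)
  have "(1 - h) * (\<Sum>i\<in>S. p i * H i) \<le> Q * (a * T)"
    using feas[OF S] a_pos T(2) by (simp add: Q_def)
  also have "\<dots> \<le> Q * (N / (1 - 2 * h))"
    using N h Q by (intro mult_left_mono) (auto simp: field_simps)
  finally have "(1 - h) * (\<Sum>i\<in>S. p i * H i) * (1 - 2 * h) \<le> Q * N"
    using h by (simp add: pos_le_divide_eq)
  then have "(\<Sum>i\<in>S. p i * H i) * ((1 - h) * (1 - 2 * h)) \<le> Q * N" by (simp add: mult_ac)
  moreover have h2: "0 < (1 - h) * (1 - 2 * h)" using h by simp
  ultimately have "(\<Sum>i\<in>S. p i * H i) \<le> Q * N / ((1 - h) * (1 - 2 * h))"
    by (simp only: pos_le_divide_eq)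
  then have "(\<Sum>i\<in>S. p i * H i) / N \<le> 1 / ((1 - h) * (1 - 2 * h)) * Q"
    using N0 by (simp add: pos_divide_le_eq mult_ac)
  also have "1 / ((1 - h) * (1 - 2 * h)) \<le> (1 + \<epsilon>) * ((1 - h) / (1 + 2 * h))"
  proof -
    \<comment> \<open>The only use of the relation between \<open>R\<close> and
      \<open>\<epsilon>\<close>: it says \<open>1 <= (1 + \<epsilon>) * (1 - 8 * h)\<close>.\<close>
    have "8 * (1 + \<epsilon>) / \<epsilon> \<le> R" using \<epsilon> by (simp add: field_simps)
    then have "h * (8 * (1 + \<epsilon>)) \<le> h * (R * \<epsilon>)"
      using \<epsilon> h by (intro mult_left_mono) (auto simp: field_simps)
    also have "\<dots> = \<epsilon>" using h(3) by simp
    finally have e: "1 \<le> (1 + \<epsilon>) * (1 - 8 * h)" by (simp add: algebra_simps)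
    have "(1 + 2 * h) * (1 - 8 * h) \<le> (1 - h) * ((1 - h) * (1 - 2 * h))"
    proof -
      have "0 \<le> h * (2 + 21 * h - 2 * h\<^sup>2)"
        using h mult_mono[of h 1 h 1] by (intro mult_nonneg_nonneg) (auto simp: power2_eq_square)
      then show ?thesis by (simp add: algebra_simps power2_eq_square)
    qed
    then have "1 - 8 * h \<le> (1 - h) * ((1 - h) * (1 - 2 * h)) / (1 + 2 * h)"
      using h by (simp add: field_simps)
    then have "(1 + \<epsilon>) * (1 - 8 * h) \<le> (1 + \<epsilon>) * ((1 - h) * ((1 - h) * (1 - 2 * h)) / (1 + 2 * h))"
      using \<epsilon> by (intro mult_left_mono) auto
    with e have "1 \<le> (1 + \<epsilon>) * ((1 - h) * ((1 - h) * (1 - 2 * h)) / (1 + 2 * h))" by linarith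
    then have "1 \<le> (1 + \<epsilon>) * ((1 - h) / (1 + 2 * h)) * ((1 - h) * (1 - 2 * h))" by (simp add: mult_ac)
    then show ?thesis using h2 by (simp only: pos_divide_le_eq)
  qed
  also have "(1 + \<epsilon>) * ((1 - h) / (1 + 2 * h)) * Q \<le> (1 + \<epsilon>) * (p j * g j / T)"
    using lo \<epsilon> unfolding Q_def mult.assoc by (intro mult_left_mono) auto
  finally show ?thesis
    using Q by (simp add: N_def T_def flip: sum_divide_distrib)
qed

end

section \<open>The program\<close>

abbreviation ix :: "name \<Rightarrow> iexp \<Rightarrow> iexp" where "ix x e \<equiv> IGet x e (INum 0)"
abbreviation rx :: "name \<Rightarrow> iexp \<Rightarrow> rexp" where "rx x e \<equiv> RGet x e (INum 0)"

abbreviation mE :: "iexp \<Rightarrow> rexp" where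
  "mE e \<equiv> RDiv (RMul (rv ''a'') (rx ''p'' e)) (RAdd (RNum 1) (RMul (rv ''a'') (rx ''p'' e)))"

abbreviation Suc_e :: "iexp \<Rightarrow> iexp" where "Suc_e e \<equiv> IAdd e (INum 1)"

definition prep_body :: com where
  "prep_body =
     setr ''W'' (RAdd (rv ''W'') (rx ''w'' (iv ''j''))) ;;
     Cond (RLess (rv ''vm'') (RMul (rx ''w'' (iv ''j'')) (mE (iv ''j''))))
       (setr ''vm'' (RMul (rx ''w'' (iv ''j'')) (mE (iv ''j'')))) Skip"

definition prep :: com where
  "prep = setr ''W'' (RNum 0) ;; setr ''vm'' (RNum 0) ;;
     For ''j'' (INum 1) (Suc_e (iv ''n'')) prep_body"

definition row_body :: com where
  "row_body =
     Cond (RLess (RAdd (RGet ''f'' (ISub (iv ''j'') (INum 1)) (ISub (iv ''v'') (iv ''q'')))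
         (rx ''c'' (iv ''j''))) (RGet ''f'' (ISub (iv ''j'') (INum 1)) (iv ''v'')))
       (RSet ''f'' (iv ''j'') (iv ''v'')
         (RAdd (RGet ''f'' (ISub (iv ''j'') (INum 1)) (ISub (iv ''v'') (iv ''q''))) (rx ''c'' (iv ''j''))))
       (RSet ''f'' (iv ''j'') (iv ''v'') (RGet ''f'' (ISub (iv ''j'') (INum 1)) (iv ''v'')))"

text \<open>\<open>H\<close> is updated here, before backtracking changes any weight, because the
  average uses the weights against which the set is chosen. The rounded reward is kept in
  \<open>r\<close> for the backtracking.\<close>

definition table_body :: com where
  "table_body =
     RSet ''H'' (iv ''j'') (INum 0) (RAdd (rx ''H'' (iv ''j'')) (RMul (RDiv (rx ''w'' (iv ''j'')) (rv ''W''))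
       (RDiv (mE (iv ''j'')) (rx ''p'' (iv ''j''))))) ;;
     Ceil ''q'' (RDiv (RMul (RMul (rx ''w'' (iv ''j'')) (mE (iv ''j''))) (RMul (rv ''nr'') (rv ''R''))) (rv ''vm'')) ;;
     ISet ''r'' (iv ''j'') (INum 0) (iv ''q'') ;;
     For ''v'' (INum 0) (Suc_e (iv ''NK'')) row_body"

text \<open>The middle assignment addresses \<open>f\<close> at \<open>0, 0\<close>: it replaces the
  infinity \<open>k + 1\<close> by the cost 0 of the empty set.\<close>

definition table :: com where
  "table =
     For ''v'' (INum 0) (Suc_e (iv ''NK'')) (RSet ''f'' (INum 0) (iv ''v'') (RAdd (rv ''k'') (RNum 1))) ;;
     setr ''f'' (RNum 0) ;;
     For ''j'' (INum 1) (Suc_e (iv ''n'')) table_body"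

definition best :: com where
  "best = seti ''b'' (INum 0) ;;
     For ''v'' (INum 0) (Suc_e (iv ''NK''))
       (Cond (RLess (rv ''k'') (RGet ''f'' (iv ''n'') (iv ''v''))) Skip (seti ''b'' (iv ''v'')))"

text \<open>Loops only count upwards, hence \<open>i = n - x\<close>. Absent locations are written
  as 0 explicitly, since row \<open>slen\<close> may still hold a set that was merged into an
  earlier row.\<close>

definition back_body :: com where
  "back_body =
     seti ''i'' (ISub (iv ''n'') (iv ''x'')) ;;
     Cond (RLess (RGet ''f'' (iv ''i'') (iv ''b'')) (RGet ''f'' (ISub (iv ''i'') (INum 1)) (iv ''b'')))
       (ISet ''sset'' (iv ''slen'') (iv ''i'') (INum 1) ;;
        RSet ''w'' (iv ''i'') (INum 0) (RSub (rx ''w'' (iv ''i''))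
          (RDiv (RMul (rx ''w'' (iv ''i'')) (mE (iv ''i''))) (rv ''R''))) ;;
        seti ''b'' (ISub (iv ''b'') (ix ''r'' (iv ''i''))))
       (ISet ''sset'' (iv ''slen'') (iv ''i'') (INum 0))"

definition trace_back :: com where
  "trace_back = For ''x'' (INum 0) (iv ''n'') back_body"

section \<open>Verification of the weight summary and of the knapsack table\<close>

context hspe_game
begin

text \<open>The data that no round modifies; \<open>env_same\<close> transports it along every
  frame.\<close>

definition env :: "state \<Rightarrow> bool" where
  "env s \<longleftrightarrow> isc s ''n'' = n \<and> (\<forall>j\<in>{1..n}. rmem s ''c'' j 0 = c j \<and> rmem s ''p'' j 0 = p j) \<and>
     rsc s ''k'' = k \<and> rsc s ''nr'' = real n \<and> rsc s ''R'' = real R \<and> isc s ''NK'' = n * n * R \<and>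
     isc s ''T'' = rounds \<and> rsc s ''T'' = real rounds \<and> rsc s ''a'' = a"

lemma env_same:
  assumes "env s" "same X Y s s'" "''n'' \<notin> X" "''NK'' \<notin> X" "''T'' \<notin> X"
    "''c'' \<notin> Y" "''p'' \<notin> Y" "''k'' \<notin> Y" "''nr'' \<notin> Y" "''R'' \<notin> Y" "''T'' \<notin> Y" "''a'' \<notin> Y"
  shows "env s'"
  using assms(1)
  unfolding env_def assms(3-5)[THEN same_imem[OF assms(2)]] assms(6-)[THEN same_rmem[OF assms(2)]] .

lemma env_simps:
  assumes "env s"
  shows "isc s ''n'' = n" "rsc s ''k'' = k" "rsc s ''nr'' = real n" "rsc s ''R'' = real R"
    "isc s ''NK'' = n * n * R" "isc s ''T'' = rounds" "rsc s ''T'' = real rounds" "rsc s ''a'' = a"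
    "\<lbrakk>Suc 0 \<le> j; j \<le> n\<rbrakk> \<Longrightarrow> rmem s ''c'' j 0 = c j"
    "\<lbrakk>Suc 0 \<le> j; j \<le> n\<rbrakk> \<Longrightarrow> rmem s ''p'' j 0 = p j"
  using assms by (simp_all add: env_def)

lemma wp_prep:
  assumes s: "env s" and w: "\<And>j. j \<in> {1..n} \<Longrightarrow> rmem s ''w'' j 0 = w j \<and> 0 < w j"
  shows "wp prep (n * 6 + 4) (\<lambda>s'. same {''j''} {''W'', ''vm''} s s' \<and> rsc s' ''W'' = sum w {1..n} \<and>
    (\<forall>j\<in>{1..n}. w j * m j \<le> rsc s' ''vm'') \<and> (\<exists>j\<in>{1..n}. w j * m j = rsc s' ''vm'')) s"
proof -
  define I where "I i s' \<longleftrightarrow> same {''j''} {''W'', ''vm''} s s' \<and> rsc s' ''W'' = sum w {1..<i} \<and>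
    (\<forall>j\<in>{1..<i}. w j * m j \<le> rsc s' ''vm'') \<and>
    (rsc s' ''vm'' = 0 \<or> (\<exists>j\<in>{1..<i}. w j * m j = rsc s' ''vm''))" for i s'
  have I: "env s'" "rmem s' ''w'' = rmem s ''w''" if "I i s'" for i s'
  proof -
    have *: "same {''j''} {''W'', ''vm''} s s'" using that by (simp add: I_def)
    show "env s'" using env_same[OF s *] by simp
    show "rmem s' ''w'' = rmem s ''w''" using same_rmem[OF *, of "''w''"] by simp
  qed
  have "wp (For ''j'' (INum 1) (Suc_e (iv ''n'')) prep_body) ((n + 1 - 1) * (4 + 2) + 2) (I (n + 1)) s1"
    if "I 1 (setx ''j'' 1 s1)" for s1
  proof (rule wp_For[where Inv = I])
    fix i s' assume i: "1 \<le> i" "i < n + 1" "I i s'" "isc s' ''j'' = i"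
    have v: "rmem s' ''w'' i 0 = w i" using I(2)[OF i(3)] w i by simp
    show "wp prep_body 4 (\<lambda>s'. isc s' ''j'' = i \<and> I (Suc i) (setx ''j'' (Suc i) s')) s'"
      unfolding prep_body_def
    proof (rule wp_loopfree, goal_cases)
      case 2
      have "sum w {Suc 0..<Suc i} = sum w {Suc 0..<i} + w i" using i by simp
      moreover have "\<forall>j\<in>{Suc 0..<Suc i}. w j * m j \<le> max (rsc s' ''vm'') (w i * m i)"
        using i(3) by (auto simp: I_def less_Suc_eq max.coboundedI1)
      moreover have "max (rsc s' ''vm'') (w i * m i) = 0 \<or>
          (\<exists>j\<in>{Suc 0..<Suc i}. w j * m j = max (rsc s' ''vm'') (w i * m i))"
        using i(1,3) unfolding I_def max_def by fastforce
      ultimately show ?case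
        using i(1-3) unfolding I_def
        by (simp add: update_same update_other i(4) v env_simps[OF I(1)[OF i(3)]] m_fold max_def
              del: times_divide_eq_right times_divide_eq_left sum.op_ivl_Suc split: if_splits)
    qed simp_all
  qed (use that in \<open>auto simp: env_simps dest: I\<close>)
  then have "wp prep (n * 6 + 4) (I (n + 1)) s"
    unfolding prep_def
    by (intro wp_prefix[where T = "n * 6 + 3"] wp_prefix[where T = "n * 6 + 2"])
      (auto simp: I_def update_same update_other)
  then show ?thesis
  proof (rule wp_mono)
    fix s' assume s': "I (n + 1) s'"
    \<comment> \<open>The maximum search starts at 0; positive products rule out that
      \<open>vm\<close> kept this initial value, so it is attained.\<close>
    have "0 < w 1 * m 1" using w[of 1] m_bounds[of 1] n by simp
    moreover have "w 1 * m 1 \<le> rsc s' ''vm''" using s' n by (simp add: I_def)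
    ultimately show "same {''j''} {''W'', ''vm''} s s' \<and> rsc s' ''W'' = sum w {1..n} \<and>
      (\<forall>j\<in>{1..n}. w j * m j \<le> rsc s' ''vm'') \<and> (\<exists>j\<in>{1..n}. w j * m j = rsc s' ''vm'')"
      using s' by (auto simp: I_def atLeastLessThanSuc_atLeastAtMost)
  qed simp
qed


text \<open>The rounding of \<open>knap_oracle\<close> for the rewards
  \<open>w j * m j\<close>.\<close>

definition reward :: "(nat \<Rightarrow> real) \<Rightarrow> real \<Rightarrow> nat \<Rightarrow> nat" where
  "reward w vm j = nat \<lceil>w j * m j * (real n * real R) / vm\<rceil>"

lemma wp_row:
  assumes s: "env s" and j: "isc s ''j'' = j" "1 \<le> j" "j \<le> n" and q: "isc s ''q'' = r j"
    and f: "\<And>v. v \<le> n * n * R \<Longrightarrow> rmem s ''f'' (j - 1) v = knap r c k (j - 1) v"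
  shows "wp (For ''v'' (INum 0) (Suc_e (iv ''NK'')) row_body) ((n * n * R + 1) * 5 + 2)
    (\<lambda>s'. same {''v''} {''f''} s s' \<and> (\<forall>i v. i \<noteq> j \<longrightarrow> rmem s' ''f'' i v = rmem s ''f'' i v) \<and>
      (\<forall>v \<le> n * n * R. rmem s' ''f'' j v = knap r c k j v)) s"
proof -
  define I where "I b s' \<longleftrightarrow> same {''v''} {''f''} s s' \<and>
    (\<forall>i v. i \<noteq> j \<longrightarrow> rmem s' ''f'' i v = rmem s ''f'' i v) \<and>
    (\<forall>v < b. rmem s' ''f'' j v = knap r c k j v)" for b s'
  have I: "env s'" "isc s' ''j'' = j" "isc s' ''q'' = r j" if "I b s'" for b s'
  proof -
    have *: "same {''v''} {''f''} s s'" using that by (simp add: I_def)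
    show "env s'" using env_same[OF s *] by simp
    show "isc s' ''j'' = j" using same_imem[OF *, of "''j''"] j by simp
    show "isc s' ''q'' = r j" using same_imem[OF *, of "''q''"] q by simp
  qed
  obtain j' where j': "j = Suc j'" using j by (cases j) auto
  have "wp (For ''v'' (INum 0) (Suc_e (iv ''NK'')) row_body) ((n * n * R + 1 - 0) * (3 + 2) + 2)
      (I (n * n * R + 1)) s"
  proof (rule wp_For[where Inv = I])
    fix b s' assume b: "b < n * n * R + 1" "I b s'" "isc s' ''v'' = b"
    have f': "rmem s' ''f'' j' v = knap r c k j' v" if "v \<le> n * n * R" for v
      using b(2) f[OF that] by (simp add: I_def j')
    have f1: "rmem s' ''f'' j' b = knap r c k j' b"
      "rmem s' ''f'' j' (b - r (Suc j')) = knap r c k j' (b - r (Suc j'))"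
      using f' b(1) by auto
    have c': "rmem s' ''c'' (Suc j') 0 = c (Suc j')"
      using env_simps(9)[OF I(1)[OF b(2)], of j] j j' by simp
    show "wp row_body 3 (\<lambda>s'. isc s' ''v'' = b \<and> I (Suc b) (setx ''v'' (Suc b) s')) s'"
      unfolding row_body_def
    proof (rule wp_loopfree, goal_cases)
      case 2
      show ?case
        using b(2) unfolding I_def
        by (simp add: update_same update_other b(3) I(2,3)[OF b(2)] j' f1 c' less_Suc_eq min_def)
    qed simp_all
  next
    fix i s' assume "I i s'"
    then show "ival (Suc_e (iv ''NK'')) s' = n * n * R + 1" using I(1) by (simp add: env_simps)
  qed (auto simp: I_def)
  then show ?thesis
    by (rule wp_mono) (auto simp: I_def)
qed

lemma wp_table:
  assumes s: "env s" and w: "\<And>j. j \<in> {1..n} \<Longrightarrow> rmem s ''w'' j 0 = w j \<and> 0 < w j"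
    and W: "rsc s ''W'' = W" and vm: "rsc s ''vm'' = vm" "\<And>j. j \<in> {1..n} \<Longrightarrow> w j * m j \<le> vm" "0 < vm"
  shows "wp table (n * (n * R * 3 + n * n * R * 5 + 14) + n * n * R * 3 + 8)
    (\<lambda>s'. same {''v'', ''j'', ''q'', ''r''} {''f'', ''H'', ''q''} s s' \<and>
      (\<forall>i \<le> n. \<forall>v \<le> n * n * R. rmem s' ''f'' i v = knap (reward w vm) c k i v) \<and>
      (\<forall>j\<in>{1..n}. imem s' ''r'' j 0 = reward w vm j \<and>
        rmem s' ''H'' j 0 = rmem s ''H'' j 0 + w j / W * (m j / p j))) s"
proof -
  let ?X = "{''v'', ''j'', ''q'', ''r''}" and ?Y = "{''f'', ''H'', ''q''}" and ?r = "reward w vm"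
  define I0 where "I0 b s' \<longleftrightarrow> same ?X {''f''} s s' \<and>
    (\<forall>v<b. rmem s' ''f'' 0 v = k + 1)" for b s'
  \<comment> \<open>The last conjunct keeps the old \<open>H\<close> at locations not yet visited,
    so that each increment starts from the value before the round.\<close>
  define I where "I b s' \<longleftrightarrow> same ?X ?Y s s' \<and>
    (\<forall>i < b. \<forall>v \<le> n * n * R. rmem s' ''f'' i v = knap ?r c k i v) \<and>
    (\<forall>j\<in>{1..<b}. imem s' ''r'' j 0 = ?r j \<and>
      rmem s' ''H'' j 0 = rmem s ''H'' j 0 + w j / W * (m j / p j)) \<and>
    (\<forall>j\<ge>b. rmem s' ''H'' j 0 = rmem s ''H'' j 0)" for b s'
  have env0: "env s'" if "same ?X {''f''} s s'" for s'
    using env_same[OF s that] by simp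
  have env1: "env s'" "rmem s' ''w'' = rmem s ''w''" "rsc s' ''W'' = W" "rsc s' ''vm'' = vm"
    if "same ?X ?Y s s'" for s'
    using env_same[OF s that] same_rmem[OF that, of "''w''"] same_rmem[OF that, of "''W''"]
      same_rmem[OF that, of "''vm''"] W vm by simp_all
  \<comment> \<open>This limits the running time of the counting loop that computes the
    reward.\<close>
  have rj: "?r j \<le> n * R" if "j \<in> {1..n}" for j
  proof -
    have "w j * m j * (real n * real R) / vm \<le> real (n * R)"
      using vm(3) mult_right_mono[OF vm(2)[OF that], of "real n * real R"] by (simp add: field_simps)
    then show ?thesis unfolding reward_def by linarith
  qed
  have A: "wp (For ''v'' (INum 0) (Suc_e (iv ''NK'')) (RSet ''f'' (INum 0) (iv ''v'') (RAdd (rv ''k'') (RNum 1))))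
      ((n * n * R + 1 - 0) * (1 + 2) + 2) (I0 (n * n * R + 1)) s"
  proof (rule wp_For[where Inv = I0])
    fix b s' assume b: "b < n * n * R + 1" "I0 b s'" "isc s' ''v'' = b"
    have e: "env s'" using b(2) env0 by (simp add: I0_def)
    show "wp (RSet ''f'' (INum 0) (iv ''v'') (RAdd (rv ''k'') (RNum 1))) 1
        (\<lambda>s'. isc s' ''v'' = b \<and> I0 (Suc b) (setx ''v'' (Suc b) s')) s'"
    proof (rule wp_loopfree, goal_cases)
      case 2
      show ?case
        using b(2) unfolding I0_def
        by (simp add: update_same update_other b(3) env_simps[OF e] less_Suc_eq)
    qed simp_all
  next
    fix i s' assume "I0 i s'"
    then have "env s'" using env0 by (simp add: I0_def)
    then show "ival (Suc_e (iv ''NK'')) s' = n * n * R + 1" by (simp add: env_simps)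
  qed (auto simp: I0_def)
  have B: "wp (setr ''f'' (RNum 0)) 1 (\<lambda>s'. I 1 (setx ''j'' 1 s')) s1" if "I0 (n * n * R + 1) s1" for s1
  proof (rule wp_loopfree, goal_cases)
    case 2
    have "same ?X {''f''} s s1" using that by (simp add: I0_def)
    then have "rmem s1 ''H'' = rmem s ''H''" "same ?X ?Y s s1"
      using same_rmem[of ?X "{''f''}" s s1 "''H''"] by (auto simp: same_def)
    then show ?case
      using that unfolding I_def I0_def
      by (simp add: update_same update_other)
  qed simp_all
  have C: "wp (For ''j'' (INum 1) (Suc_e (iv ''n'')) table_body)
      ((n + 1 - 1) * (n * R * 3 + n * n * R * 5 + 12 + 2) + 2) (I (n + 1)) s1"
    if "I 1 (setx ''j'' 1 s1)" for s1
  proof (rule wp_For[where Inv = I])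
    fix j s' assume j: "1 \<le> j" "j < n + 1" "I j s'" "isc s' ''j'' = j"
    have same: "same ?X ?Y s s'" using j(3) by (simp add: I_def)
    note e = env1[OF same]
    have jn: "j \<in> {1..n}" "Suc 0 \<le> j" "j \<le> n" using j by auto
    have wj: "rmem s ''w'' j 0 = w j" using w[OF jn(1)] by simp
    define s2 where "s2 = sem (RSet ''H'' (iv ''j'') (INum 0) (RAdd (rx ''H'' (iv ''j''))
      (RMul (RDiv (rx ''w'' (iv ''j'')) (rv ''W'')) (RDiv (mE (iv ''j'')) (rx ''p'' (iv ''j'')))))) s'"
    have s2: "same {} {''H''} s' s2" "rmem s2 ''H'' j 0 = rmem s ''H'' j 0 + w j / W * (m j / p j)"
      "\<And>i. i \<noteq> j \<Longrightarrow> rmem s2 ''H'' i 0 = rmem s' ''H'' i 0"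
      using j(3) unfolding s2_def I_def
      by (simp_all add: update_same update_other j(4) wj e env_simps[OF e(1)] jn m_fold
          del: times_divide_eq_right times_divide_eq_left)
    have same2: "same ?X ?Y s s2" by (rule same_trans[OF same s2(1)]) auto
    have j2: "isc s2 ''j'' = j" using same_imem[OF s2(1)] j(4) by simp
    have D: "wp (Ceil ''q'' (RDiv (RMul (RMul (rx ''w'' (iv ''j'')) (mE (iv ''j'')))
        (RMul (rv ''nr'') (rv ''R''))) (rv ''vm''))) (?r j * 3 + 3)
        (\<lambda>s'. isc s' ''q'' = ?r j \<and> rsc s' ''q'' = real (?r j) \<and> same {''q''} {''q''} s2 s') s2"
    proof (rule wp_Ceil)
      fix s3 assume s3: "same {''q''} {''q''} s2 s3"
      have "same ?X ?Y s s3" by (rule same_trans[OF same2 s3]) auto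
      note e3 = env1[OF this]
      have j3: "isc s3 ''j'' = j" using same_imem[OF s3, of "''j''"] j2 by simp
      show "rval (RDiv (RMul (RMul (rx ''w'' (iv ''j'')) (mE (iv ''j'')))
          (RMul (rv ''nr'') (rv ''R''))) (rv ''vm'')) s3 = w j * m j * (real n * real R) / vm"
        using w[OF jn(1)] by (simp add: j3 e3 env_simps[OF e3(1)] jn m_fold
            del: times_divide_eq_right times_divide_eq_left)
    qed (simp add: reward_def)
    have E: "wp (ISet ''r'' (iv ''j'') (INum 0) (iv ''q'') ;;
        For ''v'' (INum 0) (Suc_e (iv ''NK'')) row_body) (1 + ((n * n * R + 1) * 5 + 2))
        (\<lambda>s'. isc s' ''j'' = j \<and> I (Suc j) (setx ''j'' (Suc j) s')) s3"
      if s3: "isc s3 ''q'' = ?r j \<and> rsc s3 ''q'' = real (?r j) \<and> same {''q''} {''q''} s2 s3" for s3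
    proof -
      have s3': "same ?X ?Y s s3" by (rule same_trans[OF same2 conjunct2[OF conjunct2[OF s3]]]) auto
      have j3: "isc s3 ''j'' = j" "imem s3 ''r'' = imem s' ''r''" "rmem s3 ''f'' = rmem s' ''f''"
          "rmem s3 ''H'' = rmem s2 ''H''"
        using same_imem[OF conjunct2[OF conjunct2[OF s3]], of "''j''"] j2
          same_imem[OF conjunct2[OF conjunct2[OF s3]], of "''r''"] same_imem[OF s2(1), of "''r''"]
          same_rmem[OF conjunct2[OF conjunct2[OF s3]], of "''f''"] same_rmem[OF s2(1), of "''f''"]
          same_rmem[OF conjunct2[OF conjunct2[OF s3]], of "''H''"]
        by simp_all
      define s4 where "s4 = sem (ISet ''r'' (iv ''j'') (INum 0) (iv ''q'')) s3"
      have s4: "same ?X ?Y s s4" "isc s4 ''j'' = j" "isc s4 ''q'' = ?r j" "rmem s4 = rmem s3"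
        "imem s4 ''r'' j 0 = ?r j" "\<And>i. i \<noteq> j \<Longrightarrow> imem s4 ''r'' i 0 = imem s3 ''r'' i 0"
        using s3 s3' j3 by (simp_all add: s4_def update_same update_other)
      have f4: "rmem s4 ''f'' i v = knap ?r c k i v" if "i < j" "v \<le> n * n * R" for i v
        using j(3) that by (simp add: I_def s4 j3)
      have "wp (For ''v'' (INum 0) (Suc_e (iv ''NK'')) row_body) ((n * n * R + 1) * 5 + 2)
        (\<lambda>s'. isc s' ''j'' = j \<and> I (Suc j) (setx ''j'' (Suc j) s')) s4"
      proof (rule wp_mono[OF wp_row[where r = ?r, OF env1(1)[OF s4(1)] s4(2) j(1) jn(3) s4(3)]])
        fix s5 assume s5: "same {''v''} {''f''} s4 s5 \<and>
          (\<forall>i v. i \<noteq> j \<longrightarrow> rmem s5 ''f'' i v = rmem s4 ''f'' i v) \<and>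
          (\<forall>v \<le> n * n * R. rmem s5 ''f'' j v = knap ?r c k j v)"
        have s5': "same ?X ?Y s s5" by (rule same_trans[OF s4(1) conjunct1[OF s5]]) auto
        have 5: "imem s5 ''r'' = imem s4 ''r''" "rmem s5 ''H'' = rmem s4 ''H''" "isc s5 ''j'' = j"
          using same_imem[OF conjunct1[OF s5], of "''r''"] same_rmem[OF conjunct1[OF s5], of "''H''"]
            same_imem[OF conjunct1[OF s5], of "''j''"] s4(2) by simp_all
        have F: "\<forall>i<Suc j. \<forall>v\<le>n * n * R. rmem s5 ''f'' i v = knap ?r c k i v"
          using s5 f4 by (metis less_Suc_eq)
        have Rr: "imem s5 ''r'' i 0 = ?r i \<and>
            rmem s5 ''H'' i 0 = rmem s ''H'' i 0 + w i / W * (m i / p i)" if "i \<in> {1..<Suc j}" for i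
        proof (cases "i = j")
          case True
          then show ?thesis using s2(2) s4(4,5) by (simp add: 5 j3)
        next
          case False
          then have "i \<in> {1..<j}" using that by auto
          then show ?thesis using j(3) False by (simp add: I_def 5 s4 j3 s2(3))
        qed
        have "rmem s5 ''H'' i 0 = rmem s ''H'' i 0" if "Suc j \<le> i" for i
          using j(3) that by (simp add: I_def 5 s4 j3 s2(3))
        then show "isc s5 ''j'' = j \<and> I (Suc j) (setx ''j'' (Suc j) s5)"
          unfolding I_def using s5' F Rr 5(3) by simp
      qed (use f4 jn in auto)
      then show ?thesis
        by (intro wp_prefix[where T = "(n * n * R + 1) * 5 + 2"]) (simp_all add: s4_def)
    qed
    have "wp table_body (1 + (?r j * 3 + 3 + (1 + ((n * n * R + 1) * 5 + 2))))
        (\<lambda>s'. isc s' ''j'' = j \<and> I (Suc j) (setx ''j'' (Suc j) s')) s'"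
      unfolding table_body_def
      by (rule wp_prefix[where T = "?r j * 3 + 3 + (1 + ((n * n * R + 1) * 5 + 2))"],
          rule wp_Seq[OF D[unfolded s2_def] E[unfolded s2_def]]) auto
    then show "wp table_body (n * R * 3 + n * n * R * 5 + 12)
        (\<lambda>s'. isc s' ''j'' = j \<and> I (Suc j) (setx ''j'' (Suc j) s')) s'"
      by (rule wp_mono) (use rj[OF jn(1)] in auto)
  next
    fix i s' assume "I i s'"
    then have "env s'" using env1 by (simp add: I_def)
    then show "ival (Suc_e (iv ''n'')) s' = n + 1" by (simp add: env_simps)
  qed (use that in auto)
  have "wp table ((n * n * R + 1 - 0) * (1 + 2) + 2 +
      (1 + ((n + 1 - 1) * (n * R * 3 + n * n * R * 5 + 12 + 2) + 2))) (I (n + 1)) s"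
    unfolding table_def by (rule wp_Seq[OF A wp_Seq[OF B C]])
  then show ?thesis
    by (rule wp_mono) (auto simp: I_def)
qed

end

text \<open>The new set is already stored in row \<open>slen\<close>. If it equals an earlier row, only the weight of that row
  changes: a sparse form must not list the same set twice.\<close>

definition dedup_inner :: com where
  "dedup_inner = For ''j'' (INum 1) (Suc_e (iv ''n''))
     (Cond (BAnd (BNot (ILess (IGet ''sset'' (iv ''i'') (iv ''j'')) (IGet ''sset'' (iv ''slen'') (iv ''j''))))
         (BNot (ILess (IGet ''sset'' (iv ''slen'') (iv ''j'')) (IGet ''sset'' (iv ''i'') (iv ''j'')))))
       Skip (seti ''e'' (INum 0)))"

definition dedup_loop :: com where
  "dedup_loop = For ''i'' (INum 0) (iv ''slen'')
     (seti ''e'' (INum 1) ;; dedup_inner ;;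
      Cond (ILess (INum 0) (iv ''e'')) (seti ''fnd'' (iv ''i'')) Skip)"

definition dedup :: com where
  "dedup = seti ''fnd'' (iv ''slen'') ;; dedup_loop ;;
     RSet ''sval'' (iv ''fnd'') (INum 0) (RAdd (rx ''sval'' (iv ''fnd'')) (RDiv (RNum 1) (rv ''T''))) ;;
     Cond (ILess (iv ''fnd'') (iv ''slen'')) Skip (seti ''slen'' (Suc_e (iv ''slen'')))"

section \<open>Verification of backtracking and of the merging of equal sets\<close>

context hspe_game
begin

lemma wp_best:
  assumes s: "env s" and f: "\<And>v. v \<le> n * n * R \<Longrightarrow> rmem s ''f'' n v = knap r c k n v"
  shows "wp best ((n * n * R + 1) * 5 + 3) (\<lambda>s'. same {''v'', ''b''} {} s s' \<and>
    isc s' ''b'' \<le> n * n * R \<and> knap r c k n (isc s' ''b'') \<le> k \<and>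
    (\<forall>v. v \<le> n * n * R \<longrightarrow> knap r c k n v \<le> k \<longrightarrow> v \<le> isc s' ''b'')) s"
proof -
  define I where "I i s' \<longleftrightarrow> same {''v'', ''b''} {} s s' \<and>
    isc s' ''b'' \<le> n * n * R \<and> knap r c k n (isc s' ''b'') \<le> k \<and>
    (\<forall>v<i. knap r c k n v \<le> k \<longrightarrow> v \<le> isc s' ''b'')" for i s'
  have I: "env s'" "rmem s' = rmem s" if "I i s'" for i s'
  proof -
    have *: "same {''v'', ''b''} {} s s'" using that by (simp add: I_def)
    show "env s'" using env_same[OF s *] by simp
    show "rmem s' = rmem s" using * by (auto simp: same_def)
  qed
  \<comment> \<open>The initial candidate 0 is feasible because of the empty set.\<close>
  have k0: "knap r c k n 0 \<le> k"
    using knap_le[of "{}" n 0 r c k] c[of 1] n by simp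
  have "wp (For ''v'' (INum 0) (Suc_e (iv ''NK''))
       (Cond (RLess (rv ''k'') (RGet ''f'' (iv ''n'') (iv ''v''))) Skip (seti ''b'' (iv ''v''))))
      ((n * n * R + 1 - 0) * (3 + 2) + 2) (I (n * n * R + 1)) s1" if "I 0 (setx ''v'' 0 s1)" for s1
  proof (rule wp_For[where Inv = I])
    fix b s' assume b: "b < n * n * R + 1" "I b s'" "isc s' ''v'' = b"
    have fb: "rmem s' ''f'' n b = knap r c k n b" using f b(1) I(2)[OF b(2)] by simp
    show "wp (Cond (RLess (rv ''k'') (RGet ''f'' (iv ''n'') (iv ''v''))) Skip (seti ''b'' (iv ''v''))) 3
      (\<lambda>s'. isc s' ''v'' = b \<and> I (Suc b) (setx ''v'' (Suc b) s')) s'"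
    proof (rule wp_loopfree, goal_cases)
      case 2
      show ?case
        using b(1,2) unfolding I_def
        by (auto simp: update_same update_other b(3) env_simps[OF I(1)[OF b(2)]] fb less_Suc_eq not_less)
    qed simp_all
  next
    fix i s' assume "I i s'"
    then show "ival (Suc_e (iv ''NK'')) s' = n * n * R + 1" using I(1) by (simp add: env_simps)
  qed (use that in auto)
  then have "wp best ((n * n * R + 1) * 5 + 3) (I (n * n * R + 1)) s"
    unfolding best_def
    by (intro wp_prefix[where T = "(n * n * R + 1) * 5 + 2"]) (simp_all add: I_def update_same update_other k0)
  then show ?thesis
    by (rule wp_mono) (auto simp: I_def)
qed

lemma wp_trace_back:
  assumes s: "env s"
    and f: "\<And>i v. i \<le> n \<Longrightarrow> v \<le> n * n * R \<Longrightarrow> rmem s ''f'' i v = knap r c k i v"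
    and r: "\<And>j. j \<in> {1..n} \<Longrightarrow> imem s ''r'' j 0 = r j"
    and w: "\<And>j. j \<in> {1..n} \<Longrightarrow> rmem s ''w'' j 0 = w j"
    and b: "isc s ''b'' = b" "b \<le> n * n * R" and L: "isc s ''slen'' = L"
    and S: "S = picks r c k n b"
  shows "wp trace_back (n * 8 + 2) (\<lambda>s'. same {''x'', ''i'', ''b'', ''sset''} {''w''} s s' \<and>
    (\<forall>i. i \<noteq> L \<longrightarrow> imem s' ''sset'' i = imem s ''sset'' i) \<and>
    (\<forall>l\<in>{1..n}. imem s' ''sset'' L l = (if l \<in> S then 1 else 0) \<and>
      rmem s' ''w'' l 0 = (if l \<in> S then w l - w l * m l / R else w l))) s"
proof -
  let ?X = "{''x'', ''i'', ''b'', ''sset''}"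
  \<comment> \<open>After \<open>i\<close> iterations the locations above \<open>n - i\<close> are
    decided, and the current \<open>b\<close> is the remaining requirement, for which
    \<open>picks\<close> yields the rest of \<open>S\<close>.\<close>
  define I where "I i s' \<longleftrightarrow> same ?X {''w''} s s' \<and>
    (\<forall>i. i \<noteq> L \<longrightarrow> imem s' ''sset'' i = imem s ''sset'' i) \<and>
    isc s' ''b'' \<le> n * n * R \<and> picks r c k (n - i) (isc s' ''b'') = S \<inter> {1..n - i} \<and>
    (\<forall>l. n - i < l \<longrightarrow> l \<le> n \<longrightarrow> imem s' ''sset'' L l = (if l \<in> S then 1 else 0) \<and>
      rmem s' ''w'' l 0 = (if l \<in> S then w l - w l * m l / R else w l)) \<and>
    (\<forall>l. 1 \<le> l \<longrightarrow> l \<le> n - i \<longrightarrow> rmem s' ''w'' l 0 = w l)" for i s'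
  have "wp trace_back ((n - 0) * (6 + 2) + 2) (I n) s"
    unfolding trace_back_def
  proof (rule wp_For[where Inv = I])
    show "I 0 (setx ''x'' 0 s)"
      using b w S picks_subset[of r c k n b] by (auto simp: I_def)
  next
    fix i s' assume i: "i < n" "I i s'" "isc s' ''x'' = i"
    have same: "same ?X {''w''} s s'" using i(2) by (simp add: I_def)
    have e: "env s'" using env_same[OF s same] by simp
    have fr: "rmem s' ''f'' = rmem s ''f''" "imem s' ''r'' = imem s ''r''" "isc s' ''slen'' = L"
      using same_rmem[OF same, of "''f''"] same_imem[OF same, of "''r''"] same_imem[OF same, of "''slen''"] L
      by simp_all
    define i' where "i' = n - Suc i"
    define B where "B = isc s' ''b''"
    have i': "n - i = Suc i'" "n - Suc i = i'" "Suc i' \<le> n" using i by (auto simp: i'_def)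
    have B: "B \<le> n * n * R" "picks r c k (Suc i') B = S \<inter> {1..Suc i'}"
      using i(2) by (simp_all add: I_def B_def i')
    have Sc: "Suc i' \<in> S \<longleftrightarrow> knap r c k (Suc i') B < knap r c k i' B"
    proof -
      have "Suc i' \<in> S \<longleftrightarrow> Suc i' \<in> picks r c k (Suc i') B" using B(2) by simp
      then show ?thesis
        using picks_subset[of r c k i' B] picks_subset[of r c k i' "B - r (Suc i')"]
        by (auto simp del: knap.simps)
    qed
    have Sr: "picks r c k i' (if Suc i' \<in> S then B - r (Suc i') else B) = S \<inter> {1..i'}"
    proof -
      have "S \<inter> {1..i'} = picks r c k (Suc i') B \<inter> {1..i'}"
        unfolding B(2) by auto
      then show ?thesis
        using Sc picks_subset[of r c k i' B] picks_subset[of r c k i' "B - r (Suc i')"]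
        by (auto simp del: knap.simps)
    qed
    have fv: "rmem s ''f'' (Suc i') B = knap r c k (Suc i') B" "rmem s ''f'' i' B = knap r c k i' B"
      using f i' B by auto
    have rv: "imem s ''r'' (Suc i') 0 = r (Suc i')" using r i' by simp
    have wv: "rmem s' ''w'' (Suc i') 0 = w (Suc i')" using i(2) i' by (simp add: I_def)
    have l: "i' < l \<longleftrightarrow> l = Suc i' \<or> Suc i' < l" for l by auto
    show "wp back_body 6 (\<lambda>s'. isc s' ''x'' = i \<and> I (Suc i) (setx ''x'' (Suc i) s')) s'"
      unfolding back_body_def
    proof (rule wp_loopfree, goal_cases)
      case 2
      show ?case
        using i(2) Sr Sc B(1) unfolding I_def i'
        by (cases "Suc i' \<in> S")
         (simp_all add: update_same update_other update_row i(3) fr e env_simps[OF e] i' B_def[symmetric] fv rv wv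
            m_fold l del: times_divide_eq_right times_divide_eq_left picks.simps knap.simps)
    qed simp_all
  next
    fix i s' assume "I i s'"
    then have "same ?X {''w''} s s'" by (simp add: I_def)
    from env_same[OF s this] show "ival (iv ''n'') s' = n" by (simp add: env_simps)
  qed auto
  then show ?thesis
    by (rule wp_mono) (auto simp: I_def)
qed

definition row :: "state \<Rightarrow> nat \<Rightarrow> nat set" where
  "row s i = {j\<in>{1..n}. imem s ''sset'' i j \<noteq> 0}"

text \<open>The program compares cells, whereas a row as a set only depends on which cells are
  non-zero; the two agree for entries 0 and 1.\<close>

lemma row_eq_iff:
  assumes "\<And>j. j \<in> {1..n} \<Longrightarrow> imem s ''sset'' i j \<le> 1" "\<And>j. j \<in> {1..n} \<Longrightarrow> imem s ''sset'' l j \<le> 1"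
  shows "row s i = row s l \<longleftrightarrow> (\<forall>j\<in>{1..n}. imem s ''sset'' i j = imem s ''sset'' l j)"
proof
  assume r: "row s i = row s l"
  show "\<forall>j\<in>{1..n}. imem s ''sset'' i j = imem s ''sset'' l j"
  proof
    fix j assume j: "j \<in> {1..n}"
    then have "imem s ''sset'' i j \<noteq> 0 \<longleftrightarrow> imem s ''sset'' l j \<noteq> 0"
      using r unfolding row_def by blast
    then show "imem s ''sset'' i j = imem s ''sset'' l j"
      using assms[OF j] by linarith
  qed
qed (auto simp: row_def)

lemma wp_dedup_inner:
  assumes s: "isc s ''n'' = n" "isc s ''i'' = i" "isc s ''slen'' = L" "isc s ''e'' = 1"
  shows "wp dedup_inner (n * 5 + 2) (\<lambda>s'. same {''j'', ''e''} {} s s' \<and>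
    (0 < isc s' ''e'' \<longleftrightarrow> (\<forall>j\<in>{1..n}. imem s ''sset'' i j = imem s ''sset'' L j))) s"
proof -
  define I where "I b s' \<longleftrightarrow> same {''j'', ''e''} {} s s' \<and>
    (0 < isc s' ''e'' \<longleftrightarrow> (\<forall>j\<in>{1..<b}. imem s ''sset'' i j = imem s ''sset'' L j))" for b s'
  have I: "imem s' ''sset'' = imem s ''sset''" "isc s' ''n'' = n" "isc s' ''i'' = i" "isc s' ''slen'' = L"
    if "I b s'" for b s'
  proof -
    have *: "same {''j'', ''e''} {} s s'" using that by (simp add: I_def)
    show "imem s' ''sset'' = imem s ''sset''" "isc s' ''n'' = n" "isc s' ''i'' = i" "isc s' ''slen'' = L"
      using same_imem[OF *, of "''sset''"] same_imem[OF *, of "''n''"] same_imem[OF *, of "''i''"]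
        same_imem[OF *, of "''slen''"] s by simp_all
  qed
  have "wp dedup_inner ((n + 1 - 1) * (3 + 2) + 2) (I (n + 1)) s"
    unfolding dedup_inner_def
  proof (rule wp_For[where Inv = I])
    fix b s' assume b: "1 \<le> b" "b < n + 1" "I b s'" "isc s' ''j'' = b"
    show "wp (Cond (BAnd (BNot (ILess (IGet ''sset'' (iv ''i'') (iv ''j'')) (IGet ''sset'' (iv ''slen'') (iv ''j''))))
         (BNot (ILess (IGet ''sset'' (iv ''slen'') (iv ''j'')) (IGet ''sset'' (iv ''i'') (iv ''j'')))))
       Skip (seti ''e'' (INum 0))) 3 (\<lambda>s'. isc s' ''j'' = b \<and> I (Suc b) (setx ''j'' (Suc b) s')) s'"
    proof (rule wp_loopfree, goal_cases)
      case 2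
      have *: "{Suc 0..<Suc b} = insert b {Suc 0..<b}" using b(1) by auto
      show ?case
        using b(3) unfolding I_def One_nat_def *
        by (auto simp: update_same update_other b(4) I[OF b(3)])
    qed simp_all
  next
    fix b s' assume "I b s'"
    then show "ival (Suc_e (iv ''n'')) s' = n + 1" using I(2) by simp
  qed (use s in \<open>auto simp: I_def\<close>)
  then show ?thesis
    by (rule wp_mono) (auto simp: I_def)
qed

lemma wp_dedup_loop:
  assumes s: "isc s ''n'' = n" "isc s ''slen'' = L" "isc s ''fnd'' = L"
    and le: "\<And>i j. i \<le> L \<Longrightarrow> j \<in> {1..n} \<Longrightarrow> imem s ''sset'' i j \<le> 1"
  shows "wp dedup_loop (L * (n * 5 + 8) + 2) (\<lambda>s'. same {''j'', ''e'', ''i'', ''fnd''} {} s s' \<and>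
    (isc s' ''fnd'' = L \<and> (\<forall>i<L. row s i \<noteq> row s L) \<or> isc s' ''fnd'' < L \<and> row s (isc s' ''fnd'') = row s L)) s"
proof -
  let ?X = "{''j'', ''e'', ''i'', ''fnd''}"
  define I where "I b s' \<longleftrightarrow> same ?X {} s s' \<and>
    (isc s' ''fnd'' = L \<and> (\<forall>i<b. row s i \<noteq> row s L) \<or> isc s' ''fnd'' < L \<and> row s (isc s' ''fnd'') = row s L)" for b s'
  have "wp dedup_loop ((L - 0) * (n * 5 + 6 + 2) + 2) (I L) s"
    unfolding dedup_loop_def
  proof (rule wp_For[where Inv = I])
    fix b s' assume b: "b < L" "I b s'" "isc s' ''i'' = b"
    have same: "same ?X {} s s'" using b(2) by (simp add: I_def)
    have e: "imem s' ''sset'' = imem s ''sset''" "isc s' ''n'' = n" "isc s' ''slen'' = L"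
      using same_imem[OF same, of "''sset''"] same_imem[OF same, of "''n''"]
        same_imem[OF same, of "''slen''"] s by simp_all
    define s1 where "s1 = sem (seti ''e'' (INum 1)) s'"
    have s1: "isc s1 ''n'' = n" "isc s1 ''i'' = b" "isc s1 ''slen'' = L" "isc s1 ''e'' = 1"
      "same {''e''} {} s' s1" "imem s1 ''sset'' = imem s ''sset''" "isc s1 ''fnd'' = isc s' ''fnd''"
      by (simp_all add: s1_def update_same update_other e b(3))
    have "wp (dedup_inner ;; Cond (ILess (INum 0) (iv ''e'')) (seti ''fnd'' (iv ''i'')) Skip) (n * 5 + 2 + 3)
        (\<lambda>s'. isc s' ''i'' = b \<and> I (Suc b) (setx ''i'' (Suc b) s')) s1"
    proof (rule wp_Seq[OF wp_dedup_inner[OF s1(1-4)]])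
      fix s2 assume s2: "same {''j'', ''e''} {} s1 s2 \<and>
        (0 < isc s2 ''e'' \<longleftrightarrow> (\<forall>j\<in>{1..n}. imem s1 ''sset'' b j = imem s1 ''sset'' L j))"
      have "same {''j'', ''e''} {} s' s2"
        by (rule same_trans[OF s1(5) conjunct1[OF s2]]) auto
      then have same2: "same ?X {} s s2"
        by (rule same_trans[OF same]) auto
      have e2: "isc s2 ''i'' = b" "isc s2 ''fnd'' = isc s' ''fnd''"
        using same_imem[OF conjunct1[OF s2], of "''i''"] same_imem[OF conjunct1[OF s2], of "''fnd''"]
          s1 by simp_all
      have eq: "0 < isc s2 ''e'' \<longleftrightarrow> row s b = row s L"
        using row_eq_iff[of s b L] le b(1) s2 s1(6) by simp
      show "wp (Cond (ILess (INum 0) (iv ''e'')) (seti ''fnd'' (iv ''i'')) Skip) 3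
        (\<lambda>s'. isc s' ''i'' = b \<and> I (Suc b) (setx ''i'' (Suc b) s')) s2"
      proof (rule wp_loopfree, goal_cases)
        case 2
        show ?case
          using b(1,2) same2 unfolding I_def
          by (auto simp: update_same update_other e2 eq less_Suc_eq)
      qed simp_all
    qed
    then show "wp (seti ''e'' (INum 1) ;; dedup_inner ;;
      Cond (ILess (INum 0) (iv ''e'')) (seti ''fnd'' (iv ''i'')) Skip) (n * 5 + 6)
      (\<lambda>s'. isc s' ''i'' = b \<and> I (Suc b) (setx ''i'' (Suc b) s')) s'"
      unfolding s1_def by (rule wp_prefix[where T = "n * 5 + 2 + 3"]) simp_all
  next
    fix i s' assume "I i s'"
    then have "same ?X {} s s'" by (simp add: I_def)
    from same_imem[OF this, of "''slen''"] show "ival (iv ''slen'') s' = L" using s by simp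
  qed (use s in \<open>auto simp: I_def\<close>)
  then show ?thesis
    by (rule wp_mono) (auto simp: I_def)
qed

text \<open>The rows with their weights form the empirical distribution of the sets so far, each of
  the \<open>t\<close> rounds carrying weight \<open>1 / rounds\<close>. The bound
  \<open>L <= t\<close> limits the time for merging, injectivity prevents repeated sets, and zero
  weights beyond \<open>L\<close> let a new row be filled by mere addition.\<close>

definition srch :: "real \<Rightarrow> (nat \<Rightarrow> real) \<Rightarrow> nat \<Rightarrow> state \<Rightarrow> bool" where
  "srch t g L s \<longleftrightarrow> isc s ''slen'' = L \<and> real L \<le> t \<and>
     (\<forall>i<L. \<forall>j\<in>{1..n}. imem s ''sset'' i j \<le> 1) \<and> inj_on (row s) {..<L} \<and>
     (\<forall>i<L. feasible (row s i) \<and> 0 < rmem s ''sval'' i 0) \<and> (\<forall>i\<ge>L. rmem s ''sval'' i 0 = 0) \<and>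
     (\<Sum>i<L. rmem s ''sval'' i 0) = t / rounds \<and>
     (\<forall>j\<in>{1..n}. (\<Sum>i<L. if j \<in> row s i then rmem s ''sval'' i 0 else 0) = g j / rounds)"

text \<open>Merging and appending are treated alike: either way \<open>1 / rounds\<close> is added
  at \<open>fnd\<close>, whose row is the new set, and the former weight there is zero when the row
  is new.\<close>

lemma srch_step:
  assumes srch: "srch t g L s" and le: "\<And>j. j \<in> {1..n} \<Longrightarrow> imem s ''sset'' L j \<le> 1"
    and feas: "feasible (row s L)"
    and fnd: "fnd = L \<and> (\<forall>i<L. row s i \<noteq> row s L) \<or> fnd < L \<and> row s fnd = row s L"
    and L': "L' = (if fnd < L then L else Suc L)"
    and s': "imem s' ''sset'' = imem s ''sset''" "isc s' ''slen'' = L'"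
      "\<And>i. rmem s' ''sval'' i 0 = rmem s ''sval'' i 0 + (if i = fnd then 1 / rounds else 0)"
  shows "srch (t + 1) (\<lambda>j. g j + (if j \<in> row s L then 1 else 0)) L' s'"
proof -
  have L: "L \<le> L'" "fnd < L'" using fnd by (auto simp: L')
  have row: "row s' = row s" by (simp add: fun_eq_iff row_def s')
  have rf: "row s fnd = row s L" using fnd by auto
  have z: "rmem s ''sval'' i 0 = 0" if "L \<le> i" for i using srch that by (simp add: srch_def)
  \<comment> \<open>Stated for an arbitrary selection \<open>P\<close> of rows, to give both the
    total weight and the weight of the rows containing a given location.\<close>
  have sum: "(\<Sum>i<L'. if P i then rmem s' ''sval'' i 0 else 0)
      = (\<Sum>i<L. if P i then rmem s ''sval'' i 0 else 0) + (if P fnd then 1 / rounds else 0)" for P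
  proof -
    have "(\<Sum>i<L'. if P i then rmem s' ''sval'' i 0 else 0)
        = (\<Sum>i<L'. (if P i then rmem s ''sval'' i 0 else 0) + (if i = fnd then (if P fnd then 1 / rounds else 0) else 0))"
      by (intro sum.cong) (auto simp: s')
    also have "\<dots> = (\<Sum>i<L'. if P i then rmem s ''sval'' i 0 else 0) + (if P fnd then 1 / rounds else 0)"
      using L by (simp add: sum.distrib)
    also have "(\<Sum>i<L'. if P i then rmem s ''sval'' i 0 else 0) = (\<Sum>i<L. if P i then rmem s ''sval'' i 0 else 0)"
      using L z by (intro sum.mono_neutral_right) auto
    finally show ?thesis .
  qed
  have le': "i < L' \<Longrightarrow> i < L \<or> i = L" for i using L' by (auto split: if_splits)
  have "inj_on (row s) {..<L'}"
  proof (cases "fnd < L")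
    case False
    then have "{..<L'} = insert L {..<L}" "row s L \<notin> row s ` {..<L}"
      using L' fnd by auto
    moreover have "inj_on (row s) {..<L}" using srch by (simp add: srch_def)
    ultimately show ?thesis by auto
  qed (use srch L' in \<open>simp add: srch_def\<close>)
  moreover have "\<forall>i<L'. feasible (row s i) \<and> 0 < rmem s' ''sval'' i 0"
  proof (intro allI impI)
    fix i assume i: "i < L'"
    have "feasible (row s i)" using le'[OF i] srch feas by (auto simp: srch_def)
    moreover have "0 < rmem s' ''sval'' i 0"
    proof (cases "i < L")
      case True
      then have "0 < rmem s ''sval'' i 0" using srch by (simp add: srch_def)
      then show ?thesis using rounds_pos by (auto simp: s' intro: add_pos_pos)
    next
      case False
      then have "i = L" "i = fnd" using le'[OF i] i fnd L' by (auto split: if_splits)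
      then show ?thesis using z[of i] rounds_pos False by (simp add: s')
    qed
    ultimately show "feasible (row s i) \<and> 0 < rmem s' ''sval'' i 0" by simp
  qed
  moreover have "\<forall>i\<ge>L'. rmem s' ''sval'' i 0 = 0"
    using L z by (auto simp: s')
  moreover have "imem s' ''sset'' i j \<le> 1" if "i < L'" "j \<in> {1..n}" for i j
    using le'[OF that(1)] le[OF that(2)] srch that(2) by (auto simp: srch_def s'(1))
  moreover have "real L' \<le> t + 1" using srch L' by (auto simp: srch_def)
  moreover have "(\<Sum>i<L'. rmem s' ''sval'' i 0) = (t + 1) / rounds"
    using sum[of "\<lambda>_. True"] srch by (simp add: srch_def add_divide_distrib)
  moreover have "(\<Sum>i<L'. if j \<in> row s i then rmem s' ''sval'' i 0 else 0)
      = (g j + (if j \<in> row s L then 1 else 0)) / rounds" if "j \<in> {1..n}" for j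
    using sum[of "\<lambda>i. j \<in> row s i"] srch that rf by (simp add: srch_def add_divide_distrib)
  ultimately show ?thesis
    unfolding srch_def row using s'(2) by simp
qed

lemma wp_dedup:
  assumes s: "env s" and srch: "srch t g L s"
    and le: "\<And>j. j \<in> {1..n} \<Longrightarrow> imem s ''sset'' L j \<le> 1" and feas: "feasible (row s L)"
  shows "wp dedup (L * (n * 5 + 8) + 7) (\<lambda>s'. same {''j'', ''e'', ''i'', ''fnd'', ''slen''} {''sval''} s s' \<and>
    (\<exists>L'. srch (t + 1) (\<lambda>j. g j + (if j \<in> row s L then 1 else 0)) L' s')) s"
proof -
  define s1 where "s1 = sem (seti ''fnd'' (iv ''slen'')) s"
  have s1: "same {''fnd''} {} s s1" "isc s1 ''n'' = n" "isc s1 ''slen'' = L" "isc s1 ''fnd'' = L"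
    "imem s1 ''sset'' = imem s ''sset''"
    using srch by (simp_all add: s1_def update_same update_other env_simps[OF s] srch_def)
  have le1: "imem s1 ''sset'' i j \<le> 1" if "i \<le> L" "j \<in> {1..n}" for i j
    using that le srch by (cases "i = L") (auto simp: s1 srch_def)
  have row1: "row s1 = row s" by (simp add: fun_eq_iff row_def s1)
  have "wp (dedup_loop ;;
     RSet ''sval'' (iv ''fnd'') (INum 0) (RAdd (rx ''sval'' (iv ''fnd'')) (RDiv (RNum 1) (rv ''T''))) ;;
     Cond (ILess (iv ''fnd'') (iv ''slen'')) Skip (seti ''slen'' (Suc_e (iv ''slen''))))
     (L * (n * 5 + 8) + 2 + 4) (\<lambda>s'. same {''j'', ''e'', ''i'', ''fnd'', ''slen''} {''sval''} s s' \<and>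
    (\<exists>L'. srch (t + 1) (\<lambda>j. g j + (if j \<in> row s L then 1 else 0)) L' s')) s1"
  proof (rule wp_Seq[OF wp_dedup_loop[OF s1(2-4) le1]])
    fix s2 assume A: "same {''j'', ''e'', ''i'', ''fnd''} {} s1 s2 \<and>
      (isc s2 ''fnd'' = L \<and> (\<forall>i<L. row s1 i \<noteq> row s1 L) \<or> isc s2 ''fnd'' < L \<and> row s1 (isc s2 ''fnd'') = row s1 L)"
    have same2: "same {''j'', ''e'', ''i'', ''fnd''} {} s s2"
      by (rule same_trans[OF s1(1) conjunct1[OF A]]) auto
    have same3: "same {''j'', ''e'', ''i'', ''fnd'', ''slen''} {''sval''} s s2"
      by (rule same_trans[OF s1(1) conjunct1[OF A]]) auto
    have e: "rmem s2 = rmem s" "imem s2 ''sset'' = imem s ''sset''" "isc s2 ''slen'' = L"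
      using same_rmem[OF same2] same_imem[OF same2, of "''sset''"] same_imem[OF conjunct1[OF A], of "''slen''"] s1
      by (simp_all add: fun_eq_iff)
    have fnd: "isc s2 ''fnd'' = L \<and> (\<forall>i<L. row s i \<noteq> row s L) \<or> isc s2 ''fnd'' < L \<and> row s (isc s2 ''fnd'') = row s L"
      using A by (simp add: row1)
    show "wp (RSet ''sval'' (iv ''fnd'') (INum 0) (RAdd (rx ''sval'' (iv ''fnd'')) (RDiv (RNum 1) (rv ''T''))) ;;
       Cond (ILess (iv ''fnd'') (iv ''slen'')) Skip (seti ''slen'' (Suc_e (iv ''slen'')))) 4
      (\<lambda>s'. same {''j'', ''e'', ''i'', ''fnd'', ''slen''} {''sval''} s s' \<and>
      (\<exists>L'. srch (t + 1) (\<lambda>j. g j + (if j \<in> row s L then 1 else 0)) L' s')) s2"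
    proof (rule wp_loopfree, goal_cases)
      case 2
      let ?C = "RSet ''sval'' (iv ''fnd'') (INum 0) (RAdd (rx ''sval'' (iv ''fnd'')) (RDiv (RNum 1) (rv ''T''))) ;;
       Cond (ILess (iv ''fnd'') (iv ''slen'')) Skip (seti ''slen'' (Suc_e (iv ''slen'')))"
      have "srch (t + 1) (\<lambda>j. g j + (if j \<in> row s L then 1 else 0))
          (if isc s2 ''fnd'' < L then L else Suc L) (sem ?C s2)"
        by (rule srch_step[OF srch le feas fnd refl])
          (simp_all add: update_same update_other e env_simps[OF s])
      moreover have "same {''j'', ''e'', ''i'', ''fnd'', ''slen''} {''sval''} s (sem ?C s2)"
        using same3 by simp
      ultimately show ?case by blast
    qed simp_all
  qed
  then show ?thesis
    unfolding dedup_def s1_def by (rule wp_prefix[where T = "L * (n * 5 + 8) + 2 + 4"]) simp_all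
qed

end

section \<open>Assembly of the whole program\<close>

definition mwu_round :: com where
  "mwu_round = prep ;; table ;; best ;; trace_back ;; dedup"

text \<open>\<open>nr\<close> obtains the real copy of \<open>n\<close> by counting. Division by a
  zero \<open>p\<close> is harmless, since \<open>D\<close> is then never read. Locations start at
  1, so \<open>bad = 0\<close> means that no degenerate location was found.\<close>

definition init :: com where
  "init = For ''j'' (INum 1) (Suc_e (iv ''n''))
     (setr ''nr'' (RAdd (rv ''nr'') (RNum 1)) ;;
      setr ''D'' (RAdd (rv ''D'') (RDiv (RNum 1) (rx ''p'' (iv ''j'')))) ;;
      RSet ''w'' (iv ''j'') (INum 0) (RNum 1) ;;
      Cond (BAnd (RLess (RNum 0) (rx ''p'' (iv ''j''))) (BNot (RLess (rv ''k'') (rx ''c'' (iv ''j'')))))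
        Skip (seti ''bad'' (iv ''j'')))"

text \<open>Row 0 of \<open>sset\<close> has not been written and thus denotes the empty set, which
  is feasible as \<open>k\<close> is nonnegative.\<close>

definition trivial_output :: com where
  "trivial_output =
     ISet ''hloc'' (INum 0) (INum 0) (iv ''bad'') ;; setr ''hval'' (RNum 1) ;; seti ''hlen'' (INum 1) ;;
     seti ''slen'' (INum 1) ;; setr ''sval'' (RNum 1)"

text \<open>Naturals cannot be multiplied, so the table width and the number of rounds are computed
  as reals and carried over by \<open>Ceil\<close>, which is exact on integers.\<close>

definition params :: com where
  "params =
     Ceil ''R'' (RAdd (RNum 8) (RDiv (RNum 8) (rv ''eps''))) ;;
     Ceil ''NK'' (RMul (RMul (rv ''nr'') (rv ''nr'')) (rv ''R'')) ;;
     Ceil ''T'' (RMul (RNum 4) (RMul (RMul (rv ''nr'') (rv ''R''))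
       (RMul (RMul (rv ''nr'') (rv ''R'')) (RMul (rv ''nr'') (rv ''R''))))) ;;
     setr ''a'' (RDiv (rv ''D'') (RMul (RMul (rv ''nr'') (rv ''nr'')) (rv ''R'')))"

definition output_hider :: com where
  "output_hider = setr ''N'' (RNum 0) ;;
     For ''j'' (INum 1) (Suc_e (iv ''n'')) (setr ''N'' (RAdd (rv ''N'') (rx ''H'' (iv ''j'')))) ;;
     For ''i'' (INum 0) (iv ''n'')
       (ISet ''hloc'' (iv ''i'') (INum 0) (Suc_e (iv ''i'')) ;;
        RSet ''hval'' (iv ''i'') (INum 0) (RDiv (rx ''H'' (Suc_e (iv ''i''))) (rv ''N''))) ;;
     seti ''hlen'' (iv ''n'')"

definition main :: com where
  "main = params ;; For ''t'' (INum 0) (iv ''T'') mwu_round ;; output_hider"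

definition hspe_alg :: com where
  "hspe_alg = init ;; Cond (ILess (INum 0) (iv ''bad'')) trivial_output main"

section \<open>The rounds, the output and the running time\<close>

context hspe_game
begin

lemma srch_cong:
  assumes "srch t g L s" "\<And>i. i < L \<Longrightarrow> imem s' ''sset'' i = imem s ''sset'' i"
    "rmem s' ''sval'' = rmem s ''sval''" "isc s' ''slen'' = isc s ''slen''"
  shows "srch t g L s'"
proof -
  have row: "row s' i = row s i" if "i < L" for i
    using assms(2)[OF that] by (simp add: row_def)
  have "inj_on (row s') {..<L} = inj_on (row s) {..<L}"
    using row by (intro inj_on_cong) auto
  moreover have "(\<Sum>i<L. if j \<in> row s' i then rmem s ''sval'' i 0 else 0) =
      (\<Sum>i<L. if j \<in> row s i then rmem s ''sval'' i 0 else 0)" for j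
    using row by (intro sum.cong) auto
  ultimately show ?thesis
    using assms(1) row assms(2) unfolding srch_def assms(3,4) by simp
qed

definition round_cost :: nat where
  "round_cost = n * 6 + 4 + (n * (n * R * 3 + n * n * R * 5 + 14) + n * n * R * 3 + 8 +
     ((n * n * R + 1) * 5 + 3 + (n * 8 + 2 + (rounds * (n * 5 + 8) + 7))))"

text \<open>Only \<open>w\<close> and \<open>H\<close> have counterparts in memory. \<open>C\<close>
  is never computed, and \<open>g\<close> is present only through the weights of the rows.\<close>

definition minv :: "real \<Rightarrow> state \<Rightarrow> bool" where
  "minv t s \<longleftrightarrow> (\<exists>w H g C L. mwu_inv t w H g C \<and> srch t g L s \<and>
     (\<forall>j\<in>{1..n}. rmem s ''w'' j 0 = w j \<and> rmem s ''H'' j 0 = H j))"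

lemma wp_mwu_round:
  assumes s: "env s" and inv: "minv t s" and t: "0 \<le> t" "t \<le> rounds"
  shows "wp mwu_round round_cost (\<lambda>s'. minv (t + 1) s' \<and>
    same {''j'', ''v'', ''q'', ''r'', ''b'', ''x'', ''i'', ''sset'', ''e'', ''fnd'', ''slen''}
      {''W'', ''vm'', ''f'', ''H'', ''q'', ''w'', ''sval''} s s') s"
proof -
  let ?X = "{''j'', ''v'', ''q'', ''r'', ''b'', ''x'', ''i'', ''sset'', ''e'', ''fnd'', ''slen''}"
  let ?Y = "{''W'', ''vm'', ''f'', ''H'', ''q'', ''w'', ''sval''}"
  obtain w H g C L where mwu: "mwu_inv t w H g C" and srch: "srch t g L s"
    and wH: "\<And>j. j \<in> {1..n} \<Longrightarrow> rmem s ''w'' j 0 = w j" "\<And>j. j \<in> {1..n} \<Longrightarrow> rmem s ''H'' j 0 = H j"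
    using inv unfolding minv_def by blast
  have w: "0 < w j" if "j \<in> {1..n}" for j
    using mwu that unfolding mwu_inv_def by (meson exp_gt_zero less_le_trans)
  have "real L \<le> rounds" using srch t by (simp add: srch_def)
  then have L: "L \<le> rounds" by simp
  let ?W = "sum w {1..n}"
  have 1: "wp prep (n * 6 + 4) (\<lambda>s'. same {''j''} {''W'', ''vm''} s s' \<and> rsc s' ''W'' = ?W \<and>
    (\<forall>j\<in>{1..n}. w j * m j \<le> rsc s' ''vm'') \<and> (\<exists>j\<in>{1..n}. w j * m j = rsc s' ''vm'')) s"
    by (rule wp_prep[OF s]) (use wH w in auto)
  show ?thesis
    unfolding mwu_round_def round_cost_def
  proof (rule wp_Seq[OF 1])
    fix s1 assume A1: "same {''j''} {''W'', ''vm''} s s1 \<and> rsc s1 ''W'' = ?W \<and>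
      (\<forall>j\<in>{1..n}. w j * m j \<le> rsc s1 ''vm'') \<and> (\<exists>j\<in>{1..n}. w j * m j = rsc s1 ''vm'')"
    then have same1: "same {''j''} {''W'', ''vm''} s s1" and W1: "rsc s1 ''W'' = ?W" by auto
    define vm where "vm = rsc s1 ''vm''"
    obtain i0 where i0: "i0 \<in> {1..n}" "w i0 * m i0 = vm" using A1 by (auto simp: vm_def)
    have vm: "w j * m j \<le> vm" if "j \<in> {1..n}" for j using A1 that by (auto simp: vm_def)
    have vm0: "0 < vm" using w[OF i0(1)] m_bounds[OF i0(1)] i0(2) by (metis mult_pos_pos)
    have e1: "env s1" using env_same[OF s same1] by simp
    have f1: "rmem s1 ''w'' = rmem s ''w''" "rmem s1 ''H'' = rmem s ''H''" "rmem s1 ''sval'' = rmem s ''sval''"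
      "imem s1 ''sset'' = imem s ''sset''" "imem s1 ''slen'' = imem s ''slen''"
      using same_rmem[OF same1] same_imem[OF same1] by simp_all
    let ?r = "reward w vm"
    have 2: "wp table (n * (n * R * 3 + n * n * R * 5 + 14) + n * n * R * 3 + 8)
      (\<lambda>s'. same {''v'', ''j'', ''q'', ''r''} {''f'', ''H'', ''q''} s1 s' \<and>
        (\<forall>i \<le> n. \<forall>v \<le> n * n * R. rmem s' ''f'' i v = knap ?r c k i v) \<and>
        (\<forall>j\<in>{1..n}. imem s' ''r'' j 0 = ?r j \<and>
          rmem s' ''H'' j 0 = rmem s1 ''H'' j 0 + w j / ?W * (m j / p j))) s1"
      by (rule wp_table[OF e1 _ W1]) (use wH w vm vm0 in \<open>auto simp: vm_def f1\<close>)
    show "wp (table ;; best ;; trace_back ;; dedup) (n * (n * R * 3 + n * n * R * 5 + 14) + n * n * R * 3 + 8 +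
       ((n * n * R + 1) * 5 + 3 + (n * 8 + 2 + (rounds * (n * 5 + 8) + 7))))
       (\<lambda>s'. minv (t + 1) s' \<and> same ?X ?Y s s') s1"
    proof (rule wp_Seq[OF 2])
      fix s2 assume A2: "same {''v'', ''j'', ''q'', ''r''} {''f'', ''H'', ''q''} s1 s2 \<and>
        (\<forall>i \<le> n. \<forall>v \<le> n * n * R. rmem s2 ''f'' i v = knap ?r c k i v) \<and>
        (\<forall>j\<in>{1..n}. imem s2 ''r'' j 0 = ?r j \<and>
          rmem s2 ''H'' j 0 = rmem s1 ''H'' j 0 + w j / ?W * (m j / p j))"
      then have same2: "same {''v'', ''j'', ''q'', ''r''} {''f'', ''H'', ''q''} s1 s2" by simp
      have t2: "\<And>i v. i \<le> n \<Longrightarrow> v \<le> n * n * R \<Longrightarrow> rmem s2 ''f'' i v = knap ?r c k i v"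
        "\<And>j. j \<in> {1..n} \<Longrightarrow> imem s2 ''r'' j 0 = ?r j"
        "\<And>j. j \<in> {1..n} \<Longrightarrow> rmem s2 ''H'' j 0 = H j + w j / ?W * (m j / p j)"
        using A2 wH(2) by (auto simp: f1)
      have e2: "env s2" using env_same[OF e1 same2] by simp
      have f2: "rmem s2 ''w'' = rmem s ''w''" "rmem s2 ''sval'' = rmem s ''sval''"
        "imem s2 ''sset'' = imem s ''sset''" "imem s2 ''slen'' = imem s ''slen''"
        using same_rmem[OF same2] same_imem[OF same2] f1 by simp_all
      show "wp (best ;; trace_back ;; dedup)
         ((n * n * R + 1) * 5 + 3 + (n * 8 + 2 + (rounds * (n * 5 + 8) + 7)))
         (\<lambda>s'. minv (t + 1) s' \<and> same ?X ?Y s s') s2"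
      proof (rule wp_Seq[OF wp_best[OF e2 t2(1)[OF order_refl]]])
        fix s3 assume A3: "same {''v'', ''b''} {} s2 s3 \<and>
          isc s3 ''b'' \<le> n * n * R \<and> knap ?r c k n (isc s3 ''b'') \<le> k \<and>
          (\<forall>v. v \<le> n * n * R \<longrightarrow> knap ?r c k n v \<le> k \<longrightarrow> v \<le> isc s3 ''b'')"
        then have same3: "same {''v'', ''b''} {} s2 s3" by simp
        define b where "b = isc s3 ''b''"
        define S where "S = picks ?r c k n b"
        have b: "b \<le> n * n * R" "knap ?r c k n b \<le> k"
          "\<And>v. knap ?r c k n v \<le> k \<Longrightarrow> v \<le> n * n * R \<Longrightarrow> v \<le> b"
          using A3 by (auto simp: b_def)
        have e3: "env s3" using env_same[OF e2 same3] by simp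
        have f3: "rmem s3 ''w'' = rmem s ''w''" "rmem s3 ''sval'' = rmem s ''sval''"
          "imem s3 ''sset'' = imem s ''sset''" "imem s3 ''slen'' = imem s ''slen''"
          "rmem s3 ''f'' = rmem s2 ''f''" "imem s3 ''r'' = imem s2 ''r''" "rmem s3 ''H'' = rmem s2 ''H''"
          using same_rmem[OF same3] same_imem[OF same3] f2 by simp_all
        have slen3: "isc s3 ''slen'' = L" using srch by (simp add: f3 srch_def)
        have S: "S \<subseteq> {1..n}" "feasible S"
          using picks_subset[of ?r c k n b] picks_correct[of n c ?r k b] c b(2)
          by (auto simp: S_def feasible_def)
        \<comment> \<open>The oracle is applied to the rewards \<open>w j * m j\<close>, the
          modified payoffs against the unnormalized weights; the normalization cancels.\<close>
        have opt: "(1 - 1 / R) * (\<Sum>j\<in>S'. w j * m j) \<le> (\<Sum>j\<in>S. w j * m j)" if "feasible S'" for S'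
          unfolding S_def
        proof (rule knap_oracle[where v = "\<lambda>j. w j * m j"])
          show "S' \<subseteq> {1..n}" "sum c S' \<le> k" using that by (auto simp: feasible_def)
          show "0 < w j * m j \<and> w j * m j \<le> vm" if "j \<in> {1..n}" for j
            using w[OF that] m_bounds[OF that] vm[OF that] by simp
        qed (use i0 vm0 c R b in \<open>auto simp: reward_def\<close>)
        note step = mwu_step[OF mwu t(1) S(1) opt]
        have 4: "wp trace_back (n * 8 + 2) (\<lambda>s'. same {''x'', ''i'', ''b'', ''sset''} {''w''} s3 s' \<and>
          (\<forall>i. i \<noteq> L \<longrightarrow> imem s' ''sset'' i = imem s3 ''sset'' i) \<and>
          (\<forall>l\<in>{1..n}. imem s' ''sset'' L l = (if l \<in> S then 1 else 0) \<and>
            rmem s' ''w'' l 0 = (if l \<in> S then w l - w l * m l / R else w l))) s3"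
          by (rule wp_trace_back[OF e3 _ _ _ b_def[symmetric] b(1) slen3 S_def])
            (use t2 wH in \<open>auto simp: f3\<close>)
        show "wp (trace_back ;; dedup) (n * 8 + 2 + (rounds * (n * 5 + 8) + 7))
           (\<lambda>s'. minv (t + 1) s' \<and> same ?X ?Y s s') s3"
        proof (rule wp_Seq[OF 4])
          fix s4 assume A4: "same {''x'', ''i'', ''b'', ''sset''} {''w''} s3 s4 \<and>
            (\<forall>i. i \<noteq> L \<longrightarrow> imem s4 ''sset'' i = imem s3 ''sset'' i) \<and>
            (\<forall>l\<in>{1..n}. imem s4 ''sset'' L l = (if l \<in> S then 1 else 0) \<and>
              rmem s4 ''w'' l 0 = (if l \<in> S then w l - w l * m l / R else w l))"
          then have same4: "same {''x'', ''i'', ''b'', ''sset''} {''w''} s3 s4" by simp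
          have e4: "env s4" using env_same[OF e3 same4] by simp
          have f4: "rmem s4 ''sval'' = rmem s ''sval''" "imem s4 ''slen'' = imem s ''slen''"
            "rmem s4 ''H'' = rmem s2 ''H''"
            using same_rmem[OF same4] same_imem[OF same4] f3 by simp_all
          have row4: "row s4 L = S" using A4 S(1) by (auto simp: row_def split: if_splits)
          have srch4: "srch t g L s4"
            by (rule srch_cong[OF srch]) (use A4 f3 f4 in auto)
          have "same {''j'', ''v'', ''q'', ''r''} {''W'', ''vm'', ''f'', ''H'', ''q''} s s2"
            by (rule same_trans[OF same1 same2]) auto
          then have "same {''j'', ''v'', ''q'', ''r'', ''b''} {''W'', ''vm'', ''f'', ''H'', ''q''} s s3"
            by (rule same_trans[OF _ same3]) auto
          then have same: "same ?X ?Y s s4"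
            by (rule same_trans[OF _ same4]) auto
          have "wp dedup (L * (n * 5 + 8) + 7) (\<lambda>s'. same {''j'', ''e'', ''i'', ''fnd'', ''slen''} {''sval''} s4 s' \<and>
            (\<exists>L'. srch (t + 1) (\<lambda>j. g j + (if j \<in> row s4 L then 1 else 0)) L' s')) s4"
            by (rule wp_dedup[OF e4 srch4]) (use A4 S row4 in auto)
          then show "wp dedup (rounds * (n * 5 + 8) + 7)
            (\<lambda>s'. minv (t + 1) s' \<and> same ?X ?Y s s') s4"
          proof (rule wp_mono)
            show "L * (n * 5 + 8) + 7 \<le> rounds * (n * 5 + 8) + 7" using L by simp
            fix s5 assume A5: "same {''j'', ''e'', ''i'', ''fnd'', ''slen''} {''sval''} s4 s5 \<and>
              (\<exists>L'. srch (t + 1) (\<lambda>j. g j + (if j \<in> row s4 L then 1 else 0)) L' s5)"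
            then have same5: "same {''j'', ''e'', ''i'', ''fnd'', ''slen''} {''sval''} s4 s5" by simp
            have f5: "rmem s5 ''w'' = rmem s4 ''w''" "rmem s5 ''H'' = rmem s2 ''H''"
              using same_rmem[OF same5] f4 by simp_all
            have "\<forall>j\<in>{1..n}. rmem s5 ''w'' j 0 = (if j \<in> S then w j - w j * m j / R else w j) \<and>
                rmem s5 ''H'' j 0 = H j + w j / ?W * (m j / p j)"
              using A4 t2(3) by (simp add: f5)
            moreover obtain L' where "srch (t + 1) (\<lambda>j. g j + (if j \<in> S then 1 else 0)) L' s5"
              using A5 unfolding row4 by blast
            ultimately have "minv (t + 1) s5"
              unfolding minv_def using step by blast
            moreover have "same ?X ?Y s s5"
              by (rule same_trans[OF same same5]) auto
            ultimately show "minv (t + 1) s5 \<and> same ?X ?Y s s5" by simp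
          qed
        qed
      qed
    qed
  qed
qed

lemma wp_rounds:
  assumes "env s" "minv 0 s"
  shows "wp (For ''t'' (INum 0) (iv ''T'') mwu_round) (rounds * (round_cost + 2) + 2)
    (\<lambda>s'. env s' \<and> minv rounds s') s"
proof -
  have minv_setx: "minv t (setx ''t'' v s') = minv t s'" for t v s'
  proof -
    have "row (setx ''t'' v s') = row s'" by (simp add: fun_eq_iff row_def)
    then show ?thesis by (simp add: minv_def srch_def cong: if_cong)
  qed
  have env_setx: "env (setx ''t'' v s') = env s'" for v s'
    by (simp add: env_def)
  have "wp (For ''t'' (INum 0) (iv ''T'') mwu_round) ((rounds - 0) * (round_cost + 2) + 2)
    (\<lambda>s'. env s' \<and> minv rounds s') s"
  proof (rule wp_For[where Inv = "\<lambda>i s'. env s' \<and> minv (real i) s'"])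
    fix i s' assume i: "i < rounds" "env s' \<and> minv (real i) s'" "isc s' ''t'' = i"
    show "wp mwu_round round_cost (\<lambda>s'. isc s' ''t'' = i \<and>
        env (setx ''t'' (Suc i) s') \<and> minv (real (Suc i)) (setx ''t'' (Suc i) s')) s'"
      unfolding minv_setx env_setx
    proof (rule wp_mono[OF wp_mwu_round[of s' "real i"]])
      fix s2 assume A: "minv (real i + 1) s2 \<and>
        same {''j'', ''v'', ''q'', ''r'', ''b'', ''x'', ''i'', ''sset'', ''e'', ''fnd'', ''slen''}
        {''W'', ''vm'', ''f'', ''H'', ''q'', ''w'', ''sval''} s' s2"
      have "isc s2 ''t'' = i" using same_imem[OF conjunct2[OF A], of "''t''"] i(3) by simp
      moreover have "env s2" using env_same[OF conjunct1[OF i(2)] conjunct2[OF A]] by simp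
      ultimately show "isc s2 ''t'' = i \<and> env s2 \<and> minv (real (Suc i)) s2"
        using A by (simp add: add.commute)
    qed (use i in auto)
  qed (use assms in \<open>auto simp: minv_setx env_setx env_simps\<close>)
  then show ?thesis by simp
qed


lemma wp_params:
  assumes R_eq: "R = nat \<lceil>8 + 8 / \<epsilon>\<rceil>"
    and s: "isc s ''n'' = n" "rsc s ''k'' = k" "rsc s ''eps'' = \<epsilon>" "rsc s ''nr'' = real n"
      "rsc s ''D'' = (\<Sum>j=1..n. 1 / p j)"
      "\<forall>j\<in>{1..n}. rmem s ''c'' j 0 = c j \<and> rmem s ''p'' j 0 = p j"
  shows "wp params (R * 3 + 3 + (n * n * R * 3 + 3 + (rounds * 3 + 3 + 1)))
    (\<lambda>s'. env s' \<and> same {''R'', ''NK'', ''T''} {''R'', ''NK'', ''T'', ''a''} s s') s"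
  unfolding params_def
proof (rule wp_Seq[OF wp_Ceil[where z = "8 + 8 / \<epsilon>" and N = R]])
  fix s1 assume A1: "isc s1 ''R'' = R \<and> rsc s1 ''R'' = real R \<and> same {''R''} {''R''} s s1"
  then have same1: "same {''R''} {''R''} s s1" by simp
  show "wp (Ceil ''NK'' (RMul (RMul (rv ''nr'') (rv ''nr'')) (rv ''R'')) ;;
     Ceil ''T'' (RMul (RNum 4) (RMul (RMul (rv ''nr'') (rv ''R''))
       (RMul (RMul (rv ''nr'') (rv ''R'')) (RMul (rv ''nr'') (rv ''R''))))) ;;
     setr ''a'' (RDiv (rv ''D'') (RMul (RMul (rv ''nr'') (rv ''nr'')) (rv ''R''))))
     (n * n * R * 3 + 3 + (rounds * 3 + 3 + 1))
    (\<lambda>s'. env s' \<and> same {''R'', ''NK'', ''T''} {''R'', ''NK'', ''T'', ''a''} s s') s1"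
  proof (rule wp_Seq[OF wp_Ceil[where z = "real (n * n * R)" and N = "n * n * R"]])
    fix s2 assume A2: "isc s2 ''NK'' = n * n * R \<and> rsc s2 ''NK'' = real (n * n * R) \<and>
      same {''NK''} {''NK''} s1 s2"
    then have same2: "same {''NK''} {''NK''} s1 s2" by simp
    show "wp (Ceil ''T'' (RMul (RNum 4) (RMul (RMul (rv ''nr'') (rv ''R''))
         (RMul (RMul (rv ''nr'') (rv ''R'')) (RMul (rv ''nr'') (rv ''R''))))) ;;
       setr ''a'' (RDiv (rv ''D'') (RMul (RMul (rv ''nr'') (rv ''nr'')) (rv ''R''))))
       (rounds * 3 + 3 + 1)
      (\<lambda>s'. env s' \<and> same {''R'', ''NK'', ''T''} {''R'', ''NK'', ''T'', ''a''} s s') s2"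
    proof (rule wp_Seq[OF wp_Ceil[where z = "real rounds" and N = rounds]])
      fix s3 assume A3: "isc s3 ''T'' = rounds \<and> rsc s3 ''T'' = real rounds \<and> same {''T''} {''T''} s2 s3"
      then have same3: "same {''T''} {''T''} s2 s3" by simp
      have "same {''R'', ''NK''} {''R'', ''NK''} s s2"
        by (rule same_trans[OF same1 same2]) auto
      then have same: "same {''R'', ''NK'', ''T''} {''R'', ''NK'', ''T'', ''a''} s s3"
        by (rule same_trans[OF _ same3]) auto
      have R3: "rsc s3 ''R'' = real R" "isc s3 ''NK'' = n * n * R"
        using A1 A2 same_rmem[OF same2, of "''R''"] same_rmem[OF same3, of "''R''"]
          same_imem[OF same3, of "''NK''"] by simp_all
      have f3: "isc s3 ''n'' = n" "rsc s3 ''k'' = k" "rsc s3 ''nr'' = real n"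
        "rsc s3 ''D'' = (\<Sum>j=1..n. 1 / p j)"
        "\<forall>j\<in>{1..n}. rmem s3 ''c'' j 0 = c j \<and> rmem s3 ''p'' j 0 = p j"
        using same_imem[OF same, of "''n''"] same_rmem[OF same, of "''k''"] same_rmem[OF same, of "''nr''"]
          same_rmem[OF same, of "''D''"] same_rmem[OF same, of "''c''"] same_rmem[OF same, of "''p''"] s
        by simp_all
      show "wp (setr ''a'' (RDiv (rv ''D'') (RMul (RMul (rv ''nr'') (rv ''nr'')) (rv ''R'')))) 1
        (\<lambda>s'. env s' \<and> same {''R'', ''NK'', ''T''} {''R'', ''NK'', ''T'', ''a''} s s') s3"
      proof (rule wp_loopfree, goal_cases)
        case 2
        show ?case
          unfolding env_def using A3 f3(5) same
          by (simp add: update_same update_other f3(1-4) R3 a_def)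
      qed simp_all
    next
      fix s' assume s': "same {''T''} {''T''} s2 s'"
      have "rsc s' ''R'' = real R" "rsc s' ''nr'' = real n"
        using A1 same_rmem[OF same2, of "''R''"] same_rmem[OF s', of "''R''"] s(4)
          same_rmem[OF same1, of "''nr''"] same_rmem[OF same2, of "''nr''"] same_rmem[OF s', of "''nr''"]
        by simp_all
      then show "rval (RMul (RNum 4) (RMul (RMul (rv ''nr'') (rv ''R''))
         (RMul (RMul (rv ''nr'') (rv ''R'')) (RMul (rv ''nr'') (rv ''R''))))) s' = real rounds"
        by (simp add: rounds_def power3_eq_cube)
    qed simp
  next
    fix s' assume s': "same {''NK''} {''NK''} s1 s'"
    have "rsc s' ''R'' = real R" "rsc s' ''nr'' = real n"
      using A1 same_rmem[OF s', of "''R''"] s(4) same_rmem[OF same1, of "''nr''"] same_rmem[OF s', of "''nr''"]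
      by simp_all
    then show "rval (RMul (RMul (rv ''nr'') (rv ''nr'')) (rv ''R'')) s' = real (n * n * R)"
      by simp
  qed (simp del: of_nat_mult)
next
  fix s' assume "same {''R''} {''R''} s s'"
  from same_rmem[OF this, of "''eps''"] s(3)
  show "rval (RAdd (RNum 8) (RDiv (RNum 8) (rv ''eps''))) s' = 8 + 8 / \<epsilon>" by simp
qed (rule R_eq)

lemma wp_output_hider:
  assumes s: "env s" and H: "\<forall>j\<in>{1..n}. rmem s ''H'' j 0 = H j"
  shows "wp output_hider (n * 7 + 6) (\<lambda>s'. same {''j'', ''i'', ''hloc'', ''hlen''} {''N'', ''hval''} s s' \<and>
    hider_output s' = map (\<lambda>i. (Suc i, H (Suc i) / sum H {1..n})) [0..<n]) s"
proof -
  let ?X = "{''j'', ''i'', ''hloc'', ''hlen''}"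
  define I where "I b s' \<longleftrightarrow> same ?X {''N'', ''hval''} s s' \<and> rsc s' ''N'' = sum H {1..<b}" for b s'
  define J where "J b s' \<longleftrightarrow> same ?X {''N'', ''hval''} s s' \<and> rsc s' ''N'' = sum H {1..n} \<and>
    (\<forall>i<b. imem s' ''hloc'' i 0 = Suc i \<and> rmem s' ''hval'' i 0 = H (Suc i) / sum H {1..n})" for b s'
  have e: "env s'" "rmem s' ''H'' = rmem s ''H''" if "same ?X {''N'', ''hval''} s s'" for s'
    using env_same[OF s that] same_rmem[OF that, of "''H''"] by simp_all
  have 1: "wp (For ''j'' (INum 1) (Suc_e (iv ''n'')) (setr ''N'' (RAdd (rv ''N'') (rx ''H'' (iv ''j'')))))
      ((n + 1 - 1) * (1 + 2) + 2) (I (n + 1)) s1" if "I 1 (setx ''j'' 1 s1)" for s1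
  proof (rule wp_For[where Inv = I])
    fix b s' assume b: "1 \<le> b" "b < n + 1" "I b s'" "isc s' ''j'' = b"
    have Hb: "rmem s' ''H'' b 0 = H b"
      using e(2)[of s'] H b by (simp add: I_def)
    show "wp (setr ''N'' (RAdd (rv ''N'') (rx ''H'' (iv ''j'')))) 1
        (\<lambda>s'. isc s' ''j'' = b \<and> I (Suc b) (setx ''j'' (Suc b) s')) s'"
    proof (rule wp_loopfree, goal_cases)
      case 2
      show ?case
        using b(1,3) unfolding I_def by (simp add: update_same update_other b(4) Hb)
    qed simp_all
  next
    fix i s' assume "I i s'"
    then have "env s'" using e by (simp add: I_def)
    then show "ival (Suc_e (iv ''n'')) s' = n + 1" by (simp add: env_simps)
  qed (use that in auto)
  have 2: "wp (For ''i'' (INum 0) (iv ''n'')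
       (ISet ''hloc'' (iv ''i'') (INum 0) (Suc_e (iv ''i'')) ;;
        RSet ''hval'' (iv ''i'') (INum 0) (RDiv (rx ''H'' (Suc_e (iv ''i''))) (rv ''N''))))
      ((n - 0) * (2 + 2) + 2) (J n) s1" if "I (n + 1) s1" for s1
  proof (rule wp_For[where Inv = J])
    show "J 0 (setx ''i'' 0 s1)"
      using that by (simp add: I_def J_def atLeastLessThanSuc_atLeastAtMost)
    have "same ?X {''N'', ''hval''} s s1" using that by (simp add: I_def)
    from e(1)[OF this] show "ival (INum 0) s1 = 0" by simp
  next
    fix b s' assume b: "b < n" "J b s'" "isc s' ''i'' = b"
    have Hb: "rmem s' ''H'' (Suc b) 0 = H (Suc b)"
      using e(2)[of s'] H b by (simp add: J_def)
    show "wp (ISet ''hloc'' (iv ''i'') (INum 0) (Suc_e (iv ''i'')) ;;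
        RSet ''hval'' (iv ''i'') (INum 0) (RDiv (rx ''H'' (Suc_e (iv ''i''))) (rv ''N''))) 2
        (\<lambda>s'. isc s' ''i'' = b \<and> J (Suc b) (setx ''i'' (Suc b) s')) s'"
    proof (rule wp_loopfree, goal_cases)
      case 2
      show ?case
        using b(2) unfolding J_def by (simp add: update_same update_other b(3) Hb less_Suc_eq)
    qed simp_all
  next
    fix i s' assume "J i s'"
    then have "env s'" using e by (simp add: J_def)
    then show "ival (iv ''n'') s' = n" by (simp add: env_simps)
  qed auto
  have 3: "wp (seti ''hlen'' (iv ''n'')) 1 (\<lambda>s'. same ?X {''N'', ''hval''} s s' \<and>
    hider_output s' = map (\<lambda>i. (Suc i, H (Suc i) / sum H {1..n})) [0..<n]) s1" if "J n s1" for s1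
  proof (rule wp_loopfree, goal_cases)
    case 2
    have "env s1" using that e by (simp add: J_def)
    then show ?case
      using that unfolding J_def by (simp add: update_same update_other env_simps hider_output_def)
  qed simp_all
  show ?thesis
    unfolding output_hider_def
  proof (rule wp_prefix[where T = "(n + 1 - 1) * (1 + 2) + 2 + ((n - 0) * (2 + 2) + 2 + 1)"])
    show "wp (For ''j'' (INum 1) (Suc_e (iv ''n'')) (setr ''N'' (RAdd (rv ''N'') (rx ''H'' (iv ''j'')))) ;;
     For ''i'' (INum 0) (iv ''n'')
       (ISet ''hloc'' (iv ''i'') (INum 0) (Suc_e (iv ''i'')) ;;
        RSet ''hval'' (iv ''i'') (INum 0) (RDiv (rx ''H'' (Suc_e (iv ''i''))) (rv ''N''))) ;;
     seti ''hlen'' (iv ''n'')) ((n + 1 - 1) * (1 + 2) + 2 + ((n - 0) * (2 + 2) + 2 + 1))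
     (\<lambda>s'. same ?X {''N'', ''hval''} s s' \<and>
      hider_output s' = map (\<lambda>i. (Suc i, H (Suc i) / sum H {1..n})) [0..<n])
     (sem (setr ''N'' (RNum 0)) s)"
      by (rule wp_Seq[OF 1 wp_Seq[OF 2 3]]) (simp_all add: I_def update_same)
  qed auto
qed

definition main_cost :: nat where
  "main_cost = R * 3 + 3 + (n * n * R * 3 + 3 + (rounds * 3 + 3 + 1)) +
     (rounds * (round_cost + 2) + 2 + (n * 7 + 6))"

lemma wp_main:
  assumes R_eq: "R = nat \<lceil>8 + 8 / \<epsilon>\<rceil>"
    and s: "isc s ''n'' = n" "rsc s ''k'' = k" "rsc s ''eps'' = \<epsilon>" "rsc s ''nr'' = real n"
      "rsc s ''D'' = (\<Sum>j=1..n. 1 / p j)"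
      "\<forall>j\<in>{1..n}. rmem s ''c'' j 0 = c j \<and> rmem s ''p'' j 0 = p j"
    and zero: "\<forall>j\<in>{1..n}. rmem s ''w'' j 0 = 1 \<and> rmem s ''H'' j 0 = 0" "isc s ''slen'' = 0"
      "\<forall>i. rmem s ''sval'' i 0 = 0"
  shows "wp main main_cost (\<lambda>s'. \<exists>w H g C L. mwu_inv rounds w H g C \<and> srch rounds g L s' \<and>
    hider_output s' = map (\<lambda>i. (Suc i, H (Suc i) / sum H {1..n})) [0..<n]) s"
  unfolding main_def main_cost_def
proof (rule wp_Seq[OF wp_params[OF R_eq s]])
  fix s1 assume A1: "env s1 \<and> same {''R'', ''NK'', ''T''} {''R'', ''NK'', ''T'', ''a''} s s1"
  then have same1: "same {''R'', ''NK'', ''T''} {''R'', ''NK'', ''T'', ''a''} s s1" by simp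
  have "srch 0 (\<lambda>_. 0) 0 s1"
    using same_rmem[OF same1, of "''sval''"] same_imem[OF same1, of "''slen''"] zero
    by (simp add: srch_def)
  then have inv: "minv 0 s1"
    unfolding minv_def using mwu_inv_init zero(1) same_rmem[OF same1, of "''w''"] same_rmem[OF same1, of "''H''"]
    by (intro exI[of _ "\<lambda>_. 1"] exI[of _ "\<lambda>_. 0"] exI[of _ 0]) auto
  show "wp (For ''t'' (INum 0) (iv ''T'') mwu_round ;; output_hider)
    (rounds * (round_cost + 2) + 2 + (n * 7 + 6))
    (\<lambda>s'. \<exists>w H g C L. mwu_inv rounds w H g C \<and> srch rounds g L s' \<and>
    hider_output s' = map (\<lambda>i. (Suc i, H (Suc i) / sum H {1..n})) [0..<n]) s1"
  proof (rule wp_Seq[OF wp_rounds[OF conjunct1[OF A1] inv]])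
    fix s2 assume A2: "env s2 \<and> minv (real rounds) s2"
    then obtain w H g C L where mwu: "mwu_inv rounds w H g C" and srch: "srch rounds g L s2"
      and H: "\<forall>j\<in>{1..n}. rmem s2 ''H'' j 0 = H j"
      unfolding minv_def by blast
    show "wp output_hider (n * 7 + 6) (\<lambda>s'. \<exists>w H g C L. mwu_inv rounds w H g C \<and> srch rounds g L s' \<and>
      hider_output s' = map (\<lambda>i. (Suc i, H (Suc i) / sum H {1..n})) [0..<n]) s2"
    proof (rule wp_mono[OF wp_output_hider[OF conjunct1[OF A2] H]])
      fix s3 assume A3: "same {''j'', ''i'', ''hloc'', ''hlen''} {''N'', ''hval''} s2 s3 \<and>
        hider_output s3 = map (\<lambda>i. (Suc i, H (Suc i) / sum H {1..n})) [0..<n]"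
      have "srch rounds g L s3"
        by (rule srch_cong[OF srch])
          (simp_all add: same_imem[OF conjunct1[OF A3]] same_rmem[OF conjunct1[OF A3]])
      then show "\<exists>w H g C L. mwu_inv rounds w H g C \<and> srch rounds g L s3 \<and>
        hider_output s3 = map (\<lambda>i. (Suc i, H (Suc i) / sum H {1..n})) [0..<n]"
        using mwu A3 by blast
    qed simp
  qed
qed

text \<open>The seventh power stems from merging: each of the \<open>4 X^3\<close> rounds compares
  its set with up to \<open>4 X^3\<close> rows of length \<open>n\<close>, where
  \<open>X = n R\<close>. All other terms are of lower order, and the coefficients sum to less than
  1000.\<close>

lemma main_cost_le: "n * 8 + 3 + main_cost + 1 \<le> 1000 * (n * R) ^ 7"
proof -
  define X where "X = n * R"
  have X: "1 \<le> X" "n \<le> X" "R \<le> X" using n R by (simp_all add: X_def)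
  have pw: "X ^ i \<le> X ^ 7" if "i \<le> 7" for i using X(1) that by (simp add: power_increasing)
  have b: "n * R = X" "n * n * R \<le> X ^ 2" "rounds = 4 * X ^ 3"
    using X(2) by (simp_all add: X_def rounds_def power2_eq_square)
  have "round_cost \<le> X * 6 + 4 + (X * (X * 3 + X ^ 2 * 5 + 14) + X ^ 2 * 3 + 8 +
     ((X ^ 2 + 1) * 5 + 3 + (X * 8 + 2 + (4 * X ^ 3 * (X * 5 + 8) + 7))))"
    unfolding round_cost_def by (intro add_mono mult_le_mono) (use X b in auto)
  also have "\<dots> = 20 * X ^ 4 + 37 * X ^ 3 + 11 * X ^ 2 + 28 * X + 29"
    by (simp add: algebra_simps power_numeral_reduce)
  finally have "rounds * (round_cost + 2) \<le> 4 * X ^ 3 * (20 * X ^ 4 + 37 * X ^ 3 + 11 * X ^ 2 + 28 * X + 31)"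
    unfolding b(3) by (intro mult_le_mono) auto
  also have "\<dots> = 80 * X ^ 7 + 148 * X ^ 6 + 44 * X ^ 5 + 112 * X ^ 4 + 124 * X ^ 3"
    by (simp add: algebra_simps power_numeral_reduce)
  finally have "n * 8 + 3 + main_cost + 1 \<le> 80 * X ^ 7 + 148 * X ^ 6 + 44 * X ^ 5 + 112 * X ^ 4 + 136 * X ^ 3 +
      3 * X ^ 2 + 18 * X ^ 1 + 22 * X ^ 0"
    unfolding main_cost_def using X b by (simp add: b(3))
  also have "\<dots> \<le> 1000 * X ^ 7"
    using pw[of 0] pw[of 1] pw[of 2] pw[of 3] pw[of 4] pw[of 5] pw[of 6] by linarith
  finally show ?thesis by (simp add: X_def)
qed

lemma searcher_payoff:
  assumes "srch t g L s" "j \<in> {1..n}"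
  shows "(\<Sum>z\<leftarrow>searcher_output n s. snd z * hspe_payoff p (fst z) j) = p j * g j / rounds"
proof -
  have "(\<Sum>z\<leftarrow>searcher_output n s. snd z * hspe_payoff p (fst z) j)
      = (\<Sum>i<L. rmem s ''sval'' i 0 * hspe_payoff p (row s i) j)"
    using assms(1)
    by (simp add: searcher_output_def srch_def row_def comp_def interv_sum_list_conv_sum_set_nat atLeast0LessThan)
  also have "\<dots> = (\<Sum>i<L. p j * (if j \<in> row s i then rmem s ''sval'' i 0 else 0))"
    by (intro sum.cong) (auto simp: hspe_payoff_def)
  also have "\<dots> = p j * (g j / rounds)"
    using assms unfolding sum_distrib_left[symmetric] by (simp add: srch_def)
  finally show ?thesis by simp
qed

text \<open>With \<open>l\<close> the Searcher's payoff at the worst location \<open>j0\<close>,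
  \<open>mwu_final\<close> at \<open>j0\<close> bounds the Hider's loss by
  \<open>(1 + \<epsilon>) * l\<close>, which is the gap that weak duality tolerates.\<close>

lemma main_correct:
  assumes \<epsilon>: "0 < \<epsilon>" "8 + 8 / \<epsilon> \<le> R"
    and mwu: "mwu_inv rounds w H g C" and srch: "srch rounds g L s"
    and ho: "hider_output s = map (\<lambda>i. (Suc i, H (Suc i) / sum H {1..n})) [0..<n]"
  shows "\<exists>x y. sparse_form (searcher_output n s) x \<and> sparse_form (hider_output s) y \<and>
    optimal_max (hspe_payoff p) (searcher_pure n c k) (hider_pure n) (1 + \<epsilon>) x \<and>
    optimal_min (hspe_payoff p) (searcher_pure n c k) (hider_pure n) (1 + \<epsilon>) y"
proof -
  have so: "searcher_output n s = map (\<lambda>i. (row s i, rmem s ''sval'' i 0)) [0..<L]"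
    using srch by (simp add: searcher_output_def row_def srch_def)
  have H: "0 < H j" if "j \<in> {1..n}" for j
    using mwu that rounds_pos by (simp add: mwu_inv_def)
  have N: "0 < sum H {1..n}" using n H by (intro sum_pos) auto
  define l where "l = (MIN j\<in>{1..n}. p j * g j / rounds)"
  have l: "l \<le> p j * g j / rounds" if "j \<in> {1..n}" for j
    unfolding l_def using that by (intro Min_le) auto
  have "l \<in> (\<lambda>j. p j * g j / rounds) ` {1..n}"
    unfolding l_def using n by (intro Min_in) auto
  then obtain j0 where j0: "j0 \<in> {1..n}" "l = p j0 * g j0 / rounds" by auto
  have shift: "(\<Sum>i<n. f (Suc i)) = (\<Sum>j=1..n. f j)" for f :: "nat \<Rightarrow> real"
    by (simp add: sum.atLeast1_atMost_eq)
  have feas: "S \<in> searcher_pure n c k \<longleftrightarrow> feasible S" for S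
    by (auto simp: searcher_pure_def feasible_def)
  show ?thesis
  proof (rule approx_optimal_lists[where l = l and u = "(1 + \<epsilon>) * l"])
    show "finite (searcher_pure n c k)"
      by (rule finite_subset[of _ "Pow {1..n}"]) (auto simp: searcher_pure_def)
    show "finite (hider_pure n)" by (simp add: hider_pure_def)
    show "distinct (map fst (searcher_output n s))"
      using srch by (simp add: so comp_def distinct_map srch_def atLeast0LessThan)
    show "0 < snd z" if "z \<in> set (searcher_output n s)" for z
      using that srch by (auto simp: so srch_def)
    show "sum_list (map snd (searcher_output n s)) = 1"
      using srch rounds_pos
      by (simp add: so srch_def comp_def interv_sum_list_conv_sum_set_nat atLeast0LessThan)
    show "fst ` set (searcher_output n s) \<subseteq> searcher_pure n c k"
      using srch by (auto simp: so feas srch_def)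
    show "l \<le> (\<Sum>z\<leftarrow>searcher_output n s. snd z * hspe_payoff p (fst z) j)" if "j \<in> hider_pure n" for j
      using that l by (simp add: searcher_payoff[OF srch] hider_pure_def)
    show "distinct (map fst (hider_output s))"
      by (simp add: ho comp_def distinct_map)
    show "0 < snd z" if "z \<in> set (hider_output s)" for z
      using that H N by (auto simp: ho)
    show "sum_list (map snd (hider_output s)) = 1"
      using N shift[of H]
      by (simp add: ho comp_def interv_sum_list_conv_sum_set_nat atLeast0LessThan flip: sum_divide_distrib)
    show "fst ` set (hider_output s) \<subseteq> hider_pure n"
      by (auto simp: ho hider_pure_def)
    show "(\<Sum>z\<leftarrow>hider_output s. snd z * hspe_payoff p S (fst z)) \<le> (1 + \<epsilon>) * l"
      if "S \<in> searcher_pure n c k" for S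
    proof -
      have S: "feasible S" "S \<subseteq> {1..n}" using that by (auto simp: feas feasible_def)
      have "(\<Sum>z\<leftarrow>hider_output s. snd z * hspe_payoff p S (fst z))
          = (\<Sum>i<n. H (Suc i) / sum H {1..n} * hspe_payoff p S (Suc i))"
        by (simp add: ho comp_def interv_sum_list_conv_sum_set_nat atLeast0LessThan)
      also have "\<dots> = (\<Sum>j=1..n. H j / sum H {1..n} * hspe_payoff p S j)"
        by (rule shift)
      also have "\<dots> = (\<Sum>j\<in>S. p j * H j / sum H {1..n})"
        using S(2) by (intro sum.mono_neutral_cong_right) (auto simp: hspe_payoff_def)
      also have "\<dots> \<le> (1 + \<epsilon>) * (p j0 * g j0 / rounds)"
        by (rule mwu_final[OF mwu S(1) j0(1) \<epsilon>])
      finally show ?thesis by (simp add: j0(2))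
    qed
  qed (use \<epsilon> in auto)
qed

end

section \<open>Initialization, degenerate instances and the theorem\<close>

lemma wp_init:
  assumes s: "isc s ''n'' = n" "rsc s ''k'' = k" "rsc s ''nr'' = 0" "rsc s ''D'' = 0" "isc s ''bad'' = 0"
      "\<forall>j\<in>{1..n}. rmem s ''c'' j 0 = c j \<and> rmem s ''p'' j 0 = p j"
  shows "wp init (n * 8 + 2) (\<lambda>s'. same {''j'', ''bad''} {''nr'', ''D'', ''w''} s s' \<and>
    rsc s' ''nr'' = real n \<and> rsc s' ''D'' = (\<Sum>j=1..n. 1 / p j) \<and> (\<forall>j\<in>{1..n}. rmem s' ''w'' j 0 = 1) \<and>
    (isc s' ''bad'' = 0 \<and> (\<forall>j\<in>{1..n}. 0 < p j \<and> c j \<le> k) \<or>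
     (\<exists>j\<in>{1..n}. isc s' ''bad'' = j \<and> (p j \<le> 0 \<or> k < c j)))) s"
proof -
  let ?X = "{''j'', ''bad''}" and ?Y = "{''nr'', ''D'', ''w''}"
  \<comment> \<open>The loop starts at 1, so \<open>b - 1\<close> locations have been counted when
    the counter is \<open>b\<close>.\<close>
  define I where "I b s' \<longleftrightarrow> same ?X ?Y s s' \<and> rsc s' ''nr'' = real b - 1 \<and>
    rsc s' ''D'' = (\<Sum>j=1..<b. 1 / p j) \<and> (\<forall>j\<in>{1..<b}. rmem s' ''w'' j 0 = 1) \<and>
    (isc s' ''bad'' = 0 \<and> (\<forall>j\<in>{1..<b}. 0 < p j \<and> c j \<le> k) \<or>
     (\<exists>j\<in>{1..<b}. isc s' ''bad'' = j \<and> (p j \<le> 0 \<or> k < c j)))" for b s'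
  have e: "isc s' ''n'' = n" "rsc s' ''k'' = k" "rmem s' ''c'' = rmem s ''c''" "rmem s' ''p'' = rmem s ''p''"
    if "I b s'" for b s'
  proof -
    have *: "same ?X ?Y s s'" using that by (simp add: I_def)
    show "isc s' ''n'' = n" "rsc s' ''k'' = k" "rmem s' ''c'' = rmem s ''c''" "rmem s' ''p'' = rmem s ''p''"
      using same_imem[OF *, of "''n''"] same_rmem[OF *, of "''k''"] same_rmem[OF *, of "''c''"]
        same_rmem[OF *, of "''p''"] s by simp_all
  qed
  have "wp init ((n + 1 - 1) * (6 + 2) + 2) (I (n + 1)) s"
    unfolding init_def
  proof (rule wp_For[where Inv = I])
    fix b s' assume b: "1 \<le> b" "b < n + 1" "I b s'" "isc s' ''j'' = b"
    have cp: "rmem s ''c'' b 0 = c b" "rmem s ''p'' b 0 = p b" using s(6) b by auto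
    have ivl: "{Suc 0..<Suc b} = insert b {Suc 0..<b}" using b(1) by auto
    show "wp (setr ''nr'' (RAdd (rv ''nr'') (RNum 1)) ;;
      setr ''D'' (RAdd (rv ''D'') (RDiv (RNum 1) (rx ''p'' (iv ''j'')))) ;;
      RSet ''w'' (iv ''j'') (INum 0) (RNum 1) ;;
      Cond (BAnd (RLess (RNum 0) (rx ''p'' (iv ''j''))) (BNot (RLess (rv ''k'') (rx ''c'' (iv ''j'')))))
        Skip (seti ''bad'' (iv ''j''))) 6 (\<lambda>s'. isc s' ''j'' = b \<and> I (Suc b) (setx ''j'' (Suc b) s')) s'"
    proof (rule wp_loopfree, goal_cases)
      case 2
      show ?case
        using b(3) unfolding I_def One_nat_def ivl
        by (auto simp: update_same update_other b(4) e[OF b(3)] cp not_less)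
    qed simp_all
  next
    fix i s' assume "I i s'"
    then show "ival (Suc_e (iv ''n'')) s' = n + 1" using e(1) by simp
  qed (use s in \<open>auto simp: I_def\<close>)
  then show ?thesis
    by (rule wp_mono) (auto simp: I_def atLeastLessThanSuc_atLeastAtMost)
qed

text \<open>A Hider at \<open>j\<close> is never captured: either no feasible set contains
  \<open>j\<close>, because costs are nonnegative and \<open>c j\<close> alone exceeds
  \<open>k\<close>, or \<open>p j\<close> is zero. The value is 0, and any feasible strategy of the
  Searcher is optimal.\<close>

lemma trivial_output_correct:
  assumes inst: "hspe_instance n c p k" and \<epsilon>: "0 < \<epsilon>"
    and j: "j \<in> {1..n}" "p j \<le> 0 \<or> k < c j"
    and out: "searcher_output n s = [({}, 1)]" "hider_output s = [(j, 1)]"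
  shows "\<exists>x y. sparse_form (searcher_output n s) x \<and> sparse_form (hider_output s) y \<and>
    optimal_max (hspe_payoff p) (searcher_pure n c k) (hider_pure n) (1 + \<epsilon>) x \<and>
    optimal_min (hspe_payoff p) (searcher_pure n c k) (hider_pure n) (1 + \<epsilon>) y"
proof (rule approx_optimal_lists[where l = 0 and u = 0])
  show "finite (searcher_pure n c k)"
    by (rule finite_subset[of _ "Pow {1..n}"]) (auto simp: searcher_pure_def)
  show "(\<Sum>z\<leftarrow>hider_output s. snd z * hspe_payoff p S (fst z)) \<le> 0" if S: "S \<in> searcher_pure n c k" for S
  proof (cases "j \<in> S")
    case True
    have "finite S" using S finite_subset by (auto simp: searcher_pure_def)
    then have "c j \<le> sum c S"
      using True S inst by (intro member_le_sum) (auto simp: searcher_pure_def hspe_instance_def)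
    then have "p j \<le> 0" using j S by (auto simp: searcher_pure_def)
    then show ?thesis using True by (simp add: out hspe_payoff_def)
  qed (simp add: out hspe_payoff_def)
qed (use inst \<epsilon> j out in \<open>auto simp: hider_pure_def searcher_pure_def hspe_instance_def hspe_payoff_def\<close>)

lemma wp_hspe_alg:
  assumes inst: "hspe_instance n c p k" and \<epsilon>: "0 < \<epsilon>" and R_eq: "R = nat \<lceil>8 + 8 / \<epsilon>\<rceil>"
  shows "wp hspe_alg (1000 * (n * R) ^ 7) (\<lambda>s. \<exists>x y.
    sparse_form (searcher_output n s) x \<and> sparse_form (hider_output s) y \<and>
    optimal_max (hspe_payoff p) (searcher_pure n c k) (hider_pure n) (1 + \<epsilon>) x \<and>
    optimal_min (hspe_payoff p) (searcher_pure n c k) (hider_pure n) (1 + \<epsilon>) y) (hspe_input n c p k \<epsilon>)"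
    (is "wp _ ?T ?Q ?s")
proof -
  have n: "1 \<le> n" using inst by (simp add: hspe_instance_def)
  have Rge: "8 + 8 / \<epsilon> \<le> R" using \<epsilon> by (simp add: R_eq)
  moreover have "0 < 8 / \<epsilon>" using \<epsilon> by simp
  ultimately have R: "8 \<le> R" by linarith
  have ge: "n * 8 + 8 \<le> ?T"
  proof -
    have "1 \<le> n * R" "n \<le> n * R" using n R by simp_all
    moreover have "n * R \<le> (n * R) ^ 7" using \<open>1 \<le> n * R\<close> self_le_power[of "n * R" 7] by simp
    ultimately show ?thesis by linarith
  qed
  have init: "wp init (n * 8 + 2) (\<lambda>s'. same {''j'', ''bad''} {''nr'', ''D'', ''w''} ?s s' \<and>
    rsc s' ''nr'' = real n \<and> rsc s' ''D'' = (\<Sum>j=1..n. 1 / p j) \<and> (\<forall>j\<in>{1..n}. rmem s' ''w'' j 0 = 1) \<and>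
    (isc s' ''bad'' = 0 \<and> (\<forall>j\<in>{1..n}. 0 < p j \<and> c j \<le> k) \<or>
     (\<exists>j\<in>{1..n}. isc s' ''bad'' = j \<and> (p j \<le> 0 \<or> k < c j)))) ?s"
    by (rule wp_init) (simp_all add: hspe_input_def)
  have "wp hspe_alg (n * 8 + 2 + (?T - (n * 8 + 2))) ?Q ?s"
    unfolding hspe_alg_def
  proof (rule wp_Seq[OF init])
    fix s1 assume A: "same {''j'', ''bad''} {''nr'', ''D'', ''w''} ?s s1 \<and>
      rsc s1 ''nr'' = real n \<and> rsc s1 ''D'' = (\<Sum>j=1..n. 1 / p j) \<and> (\<forall>j\<in>{1..n}. rmem s1 ''w'' j 0 = 1) \<and>
      (isc s1 ''bad'' = 0 \<and> (\<forall>j\<in>{1..n}. 0 < p j \<and> c j \<le> k) \<or>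
       (\<exists>j\<in>{1..n}. isc s1 ''bad'' = j \<and> (p j \<le> 0 \<or> k < c j)))"
    note frame = same_imem[OF conjunct1[OF A]] same_rmem[OF conjunct1[OF A]]
    show "wp (Cond (ILess (INum 0) (iv ''bad'')) trivial_output main) (?T - (n * 8 + 2)) ?Q s1"
    proof (cases "isc s1 ''bad'' = 0")
      case True
      then have good: "\<forall>j\<in>{1..n}. 0 < p j \<and> c j \<le> k" using A by auto
      interpret hspe_game n c p k R
        using inst good n R by unfold_locales (auto simp: hspe_instance_def)
      have "wp main main_cost (\<lambda>s'. \<exists>w H g C L. mwu_inv rounds w H g C \<and> srch rounds g L s' \<and>
          hider_output s' = map (\<lambda>i. (Suc i, H (Suc i) / sum H {1..n})) [0..<n]) s1"
        by (rule wp_main[OF R_eq]) (use A in \<open>simp_all add: frame hspe_input_def\<close>)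
      then have "wp main main_cost ?Q s1"
        by (rule wp_mono) (use main_correct[OF \<epsilon> Rge] in auto)
      then have "wp (Cond (ILess (INum 0) (iv ''bad'')) trivial_output main) (main_cost + 1) ?Q s1"
        using True by (intro wp_Cond) auto
      then show ?thesis
        by (rule wp_mono) (use main_cost_le in auto)
    next
      case False
      then obtain j where j: "j \<in> {1..n}" "isc s1 ''bad'' = j" "p j \<le> 0 \<or> k < c j" using A by auto
      have "wp trivial_output 5 ?Q s1"
      proof (rule wp_loopfree, goal_cases)
        case 2
        show ?case
          by (rule trivial_output_correct[OF inst \<epsilon> j(1,3)])
            (simp_all add: trivial_output_def searcher_output_def hider_output_def update_same update_other
              j(2) frame hspe_input_def)
      qed (simp_all add: trivial_output_def)
      then have "wp (Cond (ILess (INum 0) (iv ''bad'')) trivial_output main) (5 + 1) ?Q s1"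
        using False by (intro wp_Cond) auto
      then show ?thesis
        by (rule wp_mono) (use ge in auto)
    qed
  qed
  then show ?thesis by (rule wp_mono) (use ge in auto)
qed

lemma poly2_monom: "poly2 (monom (A * B ^ i) j) u v = poly A v * poly B v ^ i * u ^ j"
  by (simp add: poly2_def poly_monom)

theorem theorem7:
  "\<exists>(P :: com) (q :: real poly poly).
     \<forall>(n :: nat) (c :: nat \<Rightarrow> real) (p :: nat \<Rightarrow> real) (k :: real) (\<epsilon> :: real).
       hspe_instance n c p k \<and> \<epsilon> > 0 \<longrightarrow>
       (\<exists>t s x y.
          exec P (hspe_input n c p k \<epsilon>) t s \<and>
          real t \<le> poly2 q (real n) (1 / \<epsilon>) \<and>
          sparse_form (searcher_output n s) x \<and>
          sparse_form (hider_output s) y \<and>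
          optimal_max (hspe_payoff p) (searcher_pure n c k) (hider_pure n) (1 + \<epsilon>) x \<and>
          optimal_min (hspe_payoff p) (searcher_pure n c k) (hider_pure n) (1 + \<epsilon>) y)"
proof (rule exI[of _ hspe_alg], rule exI[of _ "monom ([:1000:] * [:9, 8:] ^ 7) 7"], intro allI impI)
  fix n :: nat and c p :: "nat \<Rightarrow> real" and k \<epsilon> :: real
  \<comment> \<open>The outer variable stands for \<open>n\<close> and the coefficients are
    polynomials in \<open>1/\<epsilon>\<close>; \<open>[:9, 8:]\<close> is the bound
    \<open>R <= 9 + 8/\<epsilon>\<close>, with 9 instead of 8 because of the rounding up.\<close>
  let ?q = "monom ([:1000:] * [:9, 8:] ^ 7) 7 :: real poly poly"
  assume A: "hspe_instance n c p k \<and> \<epsilon> > 0"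
  define R where "R = nat \<lceil>8 + 8 / \<epsilon>\<rceil>"
  obtain t s x y where 1: "exec hspe_alg (hspe_input n c p k \<epsilon>) t s" "t \<le> 1000 * (n * R) ^ 7"
    "sparse_form (searcher_output n s) x" "sparse_form (hider_output s) y"
    "optimal_max (hspe_payoff p) (searcher_pure n c k) (hider_pure n) (1 + \<epsilon>) x"
    "optimal_min (hspe_payoff p) (searcher_pure n c k) (hider_pure n) (1 + \<epsilon>) y"
    using wp_hspe_alg[OF conjunct1[OF A] conjunct2[OF A] R_def] unfolding wp_def by blast
  have "0 < 8 / \<epsilon>" using A by simp
  then have R: "real R \<le> 9 + 8 / \<epsilon>" unfolding R_def by linarith
  have "real t \<le> real (1000 * (n * R) ^ 7)" using 1(2) by (rule of_nat_mono)
  also have "\<dots> = 1000 * (n * real R) ^ 7" by simp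
  also have "\<dots> \<le> 1000 * (n * (9 + 8 / \<epsilon>)) ^ 7"
    using R by (intro mult_left_mono power_mono) auto
  also have "\<dots> = poly2 ?q (real n) (1 / \<epsilon>)"
    unfolding poly2_monom by (simp add: power_mult_distrib)
  finally have "real t \<le> poly2 ?q (real n) (1 / \<epsilon>)" .
  with 1(1,3-) show "\<exists>t s x y.
          exec hspe_alg (hspe_input n c p k \<epsilon>) t s \<and>
          real t \<le> poly2 ?q (real n) (1 / \<epsilon>) \<and>
          sparse_form (searcher_output n s) x \<and>
          sparse_form (hider_output s) y \<and>
          optimal_max (hspe_payoff p) (searcher_pure n c k) (hider_pure n) (1 + \<epsilon>) x \<and>
          optimal_min (hspe_payoff p) (searcher_pure n c k) (hider_pure n) (1 + \<epsilon>) y"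
    by blast
qed
end
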